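(* Consider the linear-model selection setting with selected model $\hat k_n$, fixed constant $d\ge 0$ and sequence $\lambda_n\ge(\log n)^{-1}$ described in the context. Assume a nonparametric scenario (at each sample size $n$ the true model is not in the list $\Gamma$, and it may change with $n$), with $\sigma^2$ unknown and estimated from the selected model by $\hat\sigma_n^2=\|\mathbf Y_n-\hat{\mathbf Y}_{\hat k_n}\|^2/(n-r_{\hat k_n})$. Assume there exist two sequences of integers $1\le a_n<b_n<n$ with $a_n\to\infty$ such that the following hold: (N1) $P(a_n\le r_{\hat k_n}\le b_n)\to1$ and $\sup_{a_n\le j\le b_n}\frac{B_{j,n}}{n-j}\to0$ as $n\to\infty$; (N2$'$) there exist a positive sequence $\rho_n\to0$ and a constant $c_0>0$ such that for $a_n\le j\le b_n$, $N_j\cdot L_j\le c_0e^{\rho_nE_{j,n}}$, and $$\limsup_{n\to\infty}\sum_{j=a_n}^{b_n}e^{-\rho_nE_{j,n}}=0;$$ (N3$'$) $$\limsup_{n\to\infty}\left[\sup_{\{k:\,a_n\le r_k\le b_n\}}\frac{\inf_{k^{(s)}\in S_1(k)}\|P_{k^{(s)},k}f_n\|^2}{\left[(\lambda_n\log(n)-1)r_k+d\,n^{1/2}\log(n)\right]\left[1+\|(I_n-M_k)f_n\|^2/(\sigma^2(n-r_k))\right]}\right]=0 .$$ Then the parametricness index (for estimated $\sigma$, with $\hat\sigma=\hat\sigma_n$) satisfies $\mathrm{PI}_n\stackrel{p}{\longrightarrow}1$ as $n\to\infty$.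
   Context: Regression model: $Y_i=f(x_i)+\varepsilon_i$, $i=1,\dots,n$, with fixed design points $x_i\in\mathbb R^p$, regression function $f$, and errors $\varepsilon_i$ independent $N(0,\sigma^2)$, $\sigma^2>0$. Write $\mathbf Y_n=(Y_1,\dots,Y_n)^T$, $f_n=(f(x_1),\dots,f(x_n))^T$, $I_n$ for the identity matrix and $\|\cdot\|$ for the Euclidean norm on $\mathbb R^n$. The true regression function may change with $n$. Candidate models: $\Gamma$ is the collection of indices $k$ of candidate models (it may change with $n$). Each model $k$ is a family of regression functions linear in a finite-dimensional parameter; $M_k$ is the orthogonal projection matrix onto the column space of its design matrix, $r_k=\mathrm{rank}(M_k)$, and $\hat{\mathbf Y}_k=M_k\mathbf Y_n$ is the least squares fit. For a model $k$, $S_1(k)$ is the set of all sub-models $k'$ of $k$ in $\Gamma$ (so the column space of $k'$ is contained in that of $k$) with $r_{k'}=r_k-1$. It is assumed throughout that $S_1(k)$ is nonempty for every $k\in\Gamma$ with $r_k>1$. For $k^{(s)}\in S_1(k)$, $P_{k^{(s)},k}=M_k-M_{k^{(s)}}$. Counts: $N_j$ is the number of models $k\in\Gamma$ with $r_k=j$; for $1<j<n$, $L_j=\max_{k\in\Gamma}\{\mathrm{card}(S_1(k)):r_k=j\}$. For $j<n$, $$B_{j,n}=\inf_{k\in\Gamma}\{(\lambda_n\log(n)-1)j+\|(I_n-M_k)f_n\|^2/\sigma^2+d\,n^{1/2}\log(n):r_k=j\},$$ $$E_{j,n}=\inf_{k\in\Gamma,\ r_k=j}\left\{\left[(\lambda_n\log(n)-1)j+d\,n^{1/2}\log(n)\right]\left[1+\|(I_n-M_k)f_n\|^2/((n-j)\sigma^2)\right]\right\}.$$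 Information criterion (estimated $\sigma$): for $\lambda_n\ge(\log n)^{-1}$ and a constant $d\ge0$, $$IC_{\lambda_n,d}(k,\hat\sigma^2)=\|\mathbf Y_n-\hat{\mathbf Y}_k\|^2+\lambda_n\log(n)r_k\hat\sigma^2-n\hat\sigma^2+d\,n^{1/2}\log(n)\hat\sigma^2 .$$ Parametricness index (estimated $\sigma$): let $\hat k_n\in\Gamma$ be the model selected (from the data) at sample size $n$ by a given potentially consistent model selection method (one that would select the true model with probability tending to 1 if the true model were among the candidates). Then $$\mathrm{PI}_n=\inf_{k\in S_1(\hat k_n)}\frac{IC_{\lambda_n,d}(k,\hat\sigma^2)}{IC_{\lambda_n,d}(\hat k_n,\hat\sigma^2)}\ \text{ if } r_{\hat k_n}>1,\qquad \mathrm{PI}_n=n\ \text{ if } r_{\hat k_n}=1 .$$ *)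

theory Defs
  imports "HOL-Probability.Probability" "Jordan_Normal_Form.DL_Rank"
begin

(* Vectors and matrices of size n are those of Jordan_Normal_Form, since n varies.
   Observations are numbered from 0, so at sample size n the design points are x 0, ..., x (n - 1). *)

definition vnorm :: "real Matrix.vec \<Rightarrow> real" where
  "vnorm v = sqrt (scalar_prod v v)"

definition obs_vec :: "(nat \<Rightarrow> 'x) \<Rightarrow> nat \<Rightarrow> ('x \<Rightarrow> real) \<Rightarrow> real Matrix.vec" where
  "obs_vec x n g = Matrix.vec n (\<lambda>i. g (x i))"

(* A candidate model is given by the list of its regressors: its regression functions are the
   linear combinations of them, the coefficients being the finite-dimensional parameter. *)

definition model_family :: "('x \<Rightarrow> real) list \<Rightarrow> ('x \<Rightarrow> real) set" where
  "model_family \<phi> = {\<lambda>z. \<Sum>l<length \<phi>. \<theta> l * (\<phi> ! l) z | \<theta>. True}"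

definition design_matrix :: "(nat \<Rightarrow> 'x) \<Rightarrow> nat \<Rightarrow> ('x \<Rightarrow> real) list \<Rightarrow> real Matrix.mat" where
  "design_matrix x n \<phi> = Matrix.mat n (length \<phi>) (\<lambda>(i, l). (\<phi> ! l) (x i))"

definition column_space :: "real Matrix.mat \<Rightarrow> real Matrix.vec set" where
  "column_space A = {A *\<^sub>v \<theta> | \<theta>. \<theta> \<in> carrier_vec (dim_col A)}"

definition is_orth_proj :: "nat \<Rightarrow> real Matrix.vec set \<Rightarrow> real Matrix.mat \<Rightarrow> bool" where
  "is_orth_proj n V P \<longleftrightarrow> P \<in> carrier_mat n n \<and>
     (\<forall>v\<in>carrier_vec n. P *\<^sub>v v \<in> V \<and> (\<forall>w\<in>V. scalar_prod (v - P *\<^sub>v v) w = 0))"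

(* In the following, reg k is the list of regressors of the model with index k. *)

definition proj :: "(nat \<Rightarrow> 'x) \<Rightarrow> ('k \<Rightarrow> ('x \<Rightarrow> real) list) \<Rightarrow> nat \<Rightarrow> 'k \<Rightarrow> real Matrix.mat" where
  "proj x reg n k = (THE P. is_orth_proj n (column_space (design_matrix x n (reg k))) P)"

definition rk :: "(nat \<Rightarrow> 'x) \<Rightarrow> ('k \<Rightarrow> ('x \<Rightarrow> real) list) \<Rightarrow> nat \<Rightarrow> 'k \<Rightarrow> nat" where
  "rk x reg n k = vec_space.rank n (proj x reg n k)"

definition S1 :: "(nat \<Rightarrow> 'x) \<Rightarrow> ('k \<Rightarrow> ('x \<Rightarrow> real) list) \<Rightarrow> nat \<Rightarrow> 'k set \<Rightarrow> 'k \<Rightarrow> 'k set" where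
  "S1 x reg n G k =
     {k' \<in> G. model_family (reg k') \<subseteq> model_family (reg k) \<and> rk x reg n k' + 1 = rk x reg n k}"

definition num_models :: "(nat \<Rightarrow> 'x) \<Rightarrow> ('k \<Rightarrow> ('x \<Rightarrow> real) list) \<Rightarrow> nat \<Rightarrow> 'k set \<Rightarrow> nat \<Rightarrow> nat" where
  "num_models x reg n G j = card {k \<in> G. rk x reg n k = j}"

definition max_subs :: "(nat \<Rightarrow> 'x) \<Rightarrow> ('k \<Rightarrow> ('x \<Rightarrow> real) list) \<Rightarrow> nat \<Rightarrow> 'k set \<Rightarrow> nat \<Rightarrow> nat" where
  "max_subs x reg n G j = Max {card (S1 x reg n G k) | k. k \<in> G \<and> rk x reg n k = j}"

(* Squared distance of the true mean vector from the column space of model k,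
   i.e. the squared norm of (I - M_k) f_n. *)
definition bias :: "(nat \<Rightarrow> 'x) \<Rightarrow> ('k \<Rightarrow> ('x \<Rightarrow> real) list) \<Rightarrow> nat \<Rightarrow> ('x \<Rightarrow> real) \<Rightarrow> 'k \<Rightarrow> real" where
  "bias x reg n g k = (vnorm ((1\<^sub>m n - proj x reg n k) *\<^sub>v obs_vec x n g))\<^sup>2"

(* The common expression (lambda_n log n - 1) j + d n^(1/2) log n. *)
definition pen :: "real \<Rightarrow> real \<Rightarrow> nat \<Rightarrow> nat \<Rightarrow> real" where
  "pen lam d n j = (lam * ln (real n) - 1) * real j + d * sqrt (real n) * ln (real n)"

(* Extended-real valued: the infimum is infinite if no candidate has rank j. *)
definition B_ind :: "(nat \<Rightarrow> 'x) \<Rightarrow> ('k \<Rightarrow> ('x \<Rightarrow> real) list) \<Rightarrow> real \<Rightarrow> real \<Rightarrow> real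
    \<Rightarrow> nat \<Rightarrow> 'k set \<Rightarrow> ('x \<Rightarrow> real) \<Rightarrow> nat \<Rightarrow> ereal" where
  "B_ind x reg \<sigma> lam d n G g j =
     (INF k\<in>{k \<in> G. rk x reg n k = j}.
        ereal ((lam * ln (real n) - 1) * real j + bias x reg n g k / \<sigma>\<^sup>2
               + d * sqrt (real n) * ln (real n)))"

definition E_ind :: "(nat \<Rightarrow> 'x) \<Rightarrow> ('k \<Rightarrow> ('x \<Rightarrow> real) list) \<Rightarrow> real \<Rightarrow> real \<Rightarrow> real
    \<Rightarrow> nat \<Rightarrow> 'k set \<Rightarrow> ('x \<Rightarrow> real) \<Rightarrow> nat \<Rightarrow> ereal" where
  "E_ind x reg \<sigma> lam d n G g j =
     (INF k\<in>{k \<in> G. rk x reg n k = j}.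
        ereal (pen lam d n j * (1 + bias x reg n g k / ((real n - real j) * \<sigma>\<^sup>2))))"

definition exp_ereal :: "ereal \<Rightarrow> ereal" where
  "exp_ereal z = (if z = \<infinity> then \<infinity> else if z = -\<infinity> then 0 else ereal (exp (real_of_ereal z)))"

definition IC :: "(nat \<Rightarrow> 'x) \<Rightarrow> ('k \<Rightarrow> ('x \<Rightarrow> real) list) \<Rightarrow> real \<Rightarrow> real
    \<Rightarrow> nat \<Rightarrow> real Matrix.vec \<Rightarrow> 'k \<Rightarrow> real \<Rightarrow> real" where
  "IC x reg lam d n y k s2 =
     (vnorm (y - proj x reg n k *\<^sub>v y))\<^sup>2 + lam * ln (real n) * real (rk x reg n k) * s2
       - real n * s2 + d * sqrt (real n) * ln (real n) * s2"

definition sigma2_hat :: "(nat \<Rightarrow> 'x) \<Rightarrow> ('k \<Rightarrow> ('x \<Rightarrow> real) list) \<Rightarrow> nat \<Rightarrow> real Matrix.vec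
    \<Rightarrow> 'k \<Rightarrow> real" where
  "sigma2_hat x reg n y k =
     (vnorm (y - proj x reg n k *\<^sub>v y))\<^sup>2 / (real n - real (rk x reg n k))"

(* y is the data vector, k the selected model. *)
definition PI_index :: "(nat \<Rightarrow> 'x) \<Rightarrow> ('k \<Rightarrow> ('x \<Rightarrow> real) list) \<Rightarrow> real \<Rightarrow> real
    \<Rightarrow> nat \<Rightarrow> 'k set \<Rightarrow> real Matrix.vec \<Rightarrow> 'k \<Rightarrow> real" where
  "PI_index x reg lam d n G y k =
     (let s2 = sigma2_hat x reg n y k in
      if rk x reg n k > 1
      then INF k'\<in>S1 x reg n G k. IC x reg lam d n y k' s2 / IC x reg lam d n y k s2
      else real n)"

definition data_vec :: "(nat \<Rightarrow> 'x) \<Rightarrow> (nat \<Rightarrow> 'w \<Rightarrow> real) \<Rightarrow> nat \<Rightarrow> ('x \<Rightarrow> real) \<Rightarrow> 'w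
    \<Rightarrow> real Matrix.vec" where
  "data_vec x \<epsilon> n g \<omega> = Matrix.vec n (\<lambda>i. g (x i) + \<epsilon> i \<omega>)"

definition true_model :: "(nat \<Rightarrow> 'x) \<Rightarrow> ('k \<Rightarrow> ('x \<Rightarrow> real) list) \<Rightarrow> nat \<Rightarrow> 'k set
    \<Rightarrow> ('x \<Rightarrow> real) \<Rightarrow> 'k \<Rightarrow> bool" where
  "true_model x reg n G g k \<longleftrightarrow> k \<in> G \<and> g \<in> model_family (reg k) \<and>
     (\<forall>k'\<in>G. k' \<noteq> k \<and> g \<in> model_family (reg k') \<longrightarrow> rk x reg n k < rk x reg n k')"

(* sel n is the selection rule at sample size n. Consistency is required only for regression
   functions g that do not vary with n: uniformly along local alternatives no rule has it. *)
definition potentially_consistent :: "'w measure \<Rightarrow> (nat \<Rightarrow> 'w \<Rightarrow> real) \<Rightarrow> (nat \<Rightarrow> 'x)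
    \<Rightarrow> ('k \<Rightarrow> ('x \<Rightarrow> real) list) \<Rightarrow> (nat \<Rightarrow> 'k set) \<Rightarrow> (nat \<Rightarrow> real Matrix.vec \<Rightarrow> 'k) \<Rightarrow> bool" where
  "potentially_consistent M \<epsilon> x reg \<Gamma> sel \<longleftrightarrow>
     (\<forall>g k. (\<forall>\<^sub>F n in sequentially. true_model x reg n (\<Gamma> n) g (k n)) \<longrightarrow>
        (\<lambda>n. measure M {\<omega> \<in> space M. sel n (data_vec x \<epsilon> n g \<omega>) = k n}) \<longlonglongrightarrow> 1)"

definition tendsto_in_prob :: "'w measure \<Rightarrow> (nat \<Rightarrow> 'w \<Rightarrow> real) \<Rightarrow> real \<Rightarrow> bool" where
  "tendsto_in_prob M X c \<longleftrightarrow>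
     (\<forall>e>0. (\<lambda>n. measure M {\<omega> \<in> space M. \<bar>X n \<omega> - c\<bar> > e}) \<longlonglongrightarrow> 0)"

end

theory Submission
  imports Defs
begin

text \<open>Let k be the selected model, r its rank, s2 the variance estimate and p the penalty
  (lambda_n log n - 1) r + d n^(1/2) log n. Then IC(k) = s2 p. For a submodel k' of rank r - 1 the
  projection M_k - M_k' is u u^T for a unit vector u, so that
  IC(k') / IC(k) = 1 + (u . Y)^2 / (s2 p) - lambda_n log n / p.
  By (N1) every rank j in [a_n, b_n] carries a model of bias at most sigma^2 (n - j), so E_j is at most 2 p and at most 2 (n - j), while
  (N2') makes rho_n E_j uniformly large; hence p tends to infinity and the last term vanishes.
  Two events have to be excluded, uniformly over all models k with rank in [a_n, b_n]: that the
  residual sum of squares of k is below a quarter of its mean, and that (u . error)^2 exceeds a small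
  multiple of sigma^2 E_r. Their probabilities are at most exp (- (n - r) / 8) and 2 exp (- eta E_r / 2),
  both of order exp (- 2 rho_n E_r), which the entropy condition (N2') turns into a vanishing union bound.
  Outside these events the remaining part of (u . Y)^2 / (s2 p) is the signal term, small by (N3').\<close>

unbundle no inner_syntax and no vec_syntax

section \<open>Orthonormal lists and orthogonal projections\<close>

text \<open>The bias has to be kept in every estimate. For a fixed model the mean of s2 is sigma^2
  times the factor 1 + bias / ((n - r) sigma^2), which also appears in E_j and in (N3'). Bounding s2
  below by a quarter of this mean therefore makes s2 p comparable with the very quantity that those
  conditions control; a bound by sigma^2 alone would lose the factor. As s2 p stands in the
  denominator, only the lower tail matters. It comes from Markov's inequality for exp (- S / 2),
  where S is a noncentral chi-square variable and the expectation is computed exactly. The exponent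
  2 rho_n E_j has two halves: one pays for the N_j L_j pairs of a model and a submodel, the other is
  left for the sum over j. Projections are given by a definite description, so each model is
  represented by an orthonormal list, and projections, ranks and residuals become sums over inner
  products.\<close>

definition orthonormal :: "nat \<Rightarrow> real Matrix.vec list \<Rightarrow> bool" where
  "orthonormal n us \<longleftrightarrow> set us \<subseteq> carrier_vec n \<and>
     (\<forall>i<length us. \<forall>j<length us. us ! i \<bullet> us ! j = (if i = j then 1 else 0))"

text \<open>The sum of the rank-one matrices u u^T over the list, that is U U^T for the matrix U
  with columns \<open>us\<close>.\<close>

definition onb_proj :: "nat \<Rightarrow> real Matrix.vec list \<Rightarrow> real Matrix.mat" where
  "onb_proj n us = Matrix.mat n n (\<lambda>(i, j). \<Sum>l<length us. (us ! l) $ i * (us ! l) $ j)"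

lemma orthonormal_carrier: "orthonormal n us \<Longrightarrow> l < length us \<Longrightarrow> us ! l \<in> carrier_vec n"
  by (auto simp: orthonormal_def)

lemma orthonormal_nth:
  "orthonormal n us \<Longrightarrow> i < length us \<Longrightarrow> j < length us \<Longrightarrow>
     us ! i \<bullet> us ! j = (if i = j then 1 else 0)"
  by (auto simp: orthonormal_def)

text \<open>Used in both directions: to adjoin one vector in Gram-Schmidt, and to split an extended
  basis into the part of a model and the new vectors.\<close>

lemma orthonormal_append_iff:
  "orthonormal n (us @ vs) \<longleftrightarrow> orthonormal n us \<and> orthonormal n vs \<and>
     (\<forall>u\<in>set us. \<forall>v\<in>set vs. u \<bullet> v = 0)"
proof (intro iffI conjI ballI)
  assume o: "orthonormal n (us @ vs)"
  show "orthonormal n us"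
    unfolding orthonormal_def
  proof (intro conjI allI impI)
    fix i j assume "i < length us" "j < length us"
    then show "us ! i \<bullet> us ! j = (if i = j then 1 else 0)"
      using orthonormal_nth[OF o, of i j] by (simp add: nth_append)
  qed (use o in \<open>auto simp: orthonormal_def\<close>)
  show "orthonormal n vs"
    unfolding orthonormal_def
  proof (intro conjI allI impI)
    fix i j assume "i < length vs" "j < length vs"
    then show "vs ! i \<bullet> vs ! j = (if i = j then 1 else 0)"
      using orthonormal_nth[OF o, of "length us + i" "length us + j"] by simp
  qed (use o in \<open>auto simp: orthonormal_def\<close>)
  fix u v assume "u \<in> set us" "v \<in> set vs"
  then obtain i j where "i < length us" "u = us ! i" "j < length vs" "v = vs ! j"
    by (metis in_set_conv_nth)
  then show "u \<bullet> v = 0"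
    using orthonormal_nth[OF o, of i "length us + j"] by (simp add: nth_append)
next
  assume a: "orthonormal n us \<and> orthonormal n vs \<and> (\<forall>u\<in>set us. \<forall>v\<in>set vs. u \<bullet> v = 0)"
  then have c: "set us \<subseteq> carrier_vec n" "set vs \<subseteq> carrier_vec n" by (auto simp: orthonormal_def)
  have sym: "v \<bullet> u = 0" if "u \<in> set us" "v \<in> set vs" for u v
  proof -
    have "u \<in> carrier_vec n" "v \<in> carrier_vec n" using c that by blast+
    then show ?thesis using a that comm_scalar_prod[of u n v] by simp
  qed
  show "orthonormal n (us @ vs)"
    unfolding orthonormal_def
  proof (intro conjI allI impI)
    fix i j assume ij: "i < length (us @ vs)" "j < length (us @ vs)"
    show "(us @ vs) ! i \<bullet> (us @ vs) ! j = (if i = j then 1 else 0)"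
    proof (cases "i < length us"; cases "j < length us")
      assume "\<not> i < length us" "\<not> j < length us"
      then have "i - length us = j - length us \<longleftrightarrow> i = j" by linarith
      then show ?thesis
        using ij a orthonormal_nth[of n vs "i - length us" "j - length us"] \<open>\<not> i < length us\<close> \<open>\<not> j < length us\<close>
        by (simp add: nth_append)
    qed (use ij a sym in \<open>auto simp: nth_append orthonormal_nth\<close>)
  qed (use c in auto)
qed

section \<open>Action, column space and rank of U U^T\<close>

lemma onb_proj_carrier [simp]: "onb_proj n us \<in> carrier_mat n n"
  by (simp add: onb_proj_def)

lemma onb_proj_dim [simp]: "dim_row (onb_proj n us) = n" "dim_col (onb_proj n us) = n"
  by (simp_all add: onb_proj_def)

lemma onb_proj_mult_carrier [simp]: "v \<in> carrier_vec n \<Longrightarrow> onb_proj n us *\<^sub>v v \<in> carrier_vec n"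
  by (rule mult_mat_vec_carrier[OF onb_proj_carrier])

lemma mat_of_cols_mult_carrier [simp]:
  "c \<in> carrier_vec (length us) \<Longrightarrow> mat_of_cols n us *\<^sub>v c \<in> carrier_vec n"
  by (rule mult_mat_vec_carrier[OF mat_of_cols_carrier(1)])

lemma onb_proj_mult_index:
  assumes "orthonormal n us" "v \<in> carrier_vec n" "i < n"
  shows "(onb_proj n us *\<^sub>v v) $ i = (\<Sum>l<length us. (us ! l \<bullet> v) * (us ! l) $ i)"
proof -
  have "(onb_proj n us *\<^sub>v v) $ i
      = (\<Sum>j<n. (\<Sum>l<length us. (us ! l) $ i * (us ! l) $ j) * v $ j)"
    using assms by (simp add: onb_proj_def scalar_prod_def atLeast0LessThan)
  also have "\<dots> = (\<Sum>l<length us. \<Sum>j<n. (us ! l) $ i * (us ! l) $ j * v $ j)"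
    by (subst sum.swap) (simp add: sum_distrib_right)
  also have "\<dots> = (\<Sum>l<length us. (us ! l \<bullet> v) * (us ! l) $ i)"
    using assms(2) by (simp add: scalar_prod_def atLeast0LessThan sum_distrib_left sum_distrib_right mult_ac)
  finally show ?thesis .
qed

lemma scalar_prod_onb_proj:
  assumes "orthonormal n us" "v \<in> carrier_vec n" "w \<in> carrier_vec n"
  shows "(onb_proj n us *\<^sub>v v) \<bullet> w = (\<Sum>l<length us. (us ! l \<bullet> v) * (us ! l \<bullet> w))"
proof -
  have "(onb_proj n us *\<^sub>v v) \<bullet> w = (\<Sum>i<n. (\<Sum>l<length us. (us ! l \<bullet> v) * (us ! l) $ i) * w $ i)"
    using assms by (simp add: scalar_prod_def[of "_ *\<^sub>v _"] atLeast0LessThan onb_proj_mult_index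
        del: index_mult_mat_vec)
  also have "\<dots> = (\<Sum>l<length us. \<Sum>i<n. (us ! l \<bullet> v) * (us ! l) $ i * w $ i)"
    by (subst sum.swap) (simp add: sum_distrib_right)
  also have "\<dots> = (\<Sum>l<length us. (us ! l \<bullet> v) * (us ! l \<bullet> w))"
    using assms(3) by (simp add: scalar_prod_def[of _ w] atLeast0LessThan sum_distrib_left mult_ac)
  finally show ?thesis .
qed

lemma onb_proj_residual_orth:
  assumes "orthonormal n us" "v \<in> carrier_vec n" "l < length us"
  shows "(v - onb_proj n us *\<^sub>v v) \<bullet> us ! l = 0"
proof -
  have c: "us ! l \<in> carrier_vec n" "onb_proj n us *\<^sub>v v \<in> carrier_vec n"
    using orthonormal_carrier[OF assms(1,3)] assms(2) by auto
  have "(onb_proj n us *\<^sub>v v) \<bullet> us ! l = (\<Sum>m<length us. (us ! m \<bullet> v) * (us ! m \<bullet> us ! l))"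
    using scalar_prod_onb_proj[OF assms(1,2) c(1)] .
  also have "\<dots> = (\<Sum>m<length us. if m = l then us ! m \<bullet> v else 0)"
    using assms by (intro sum.cong) (auto simp: orthonormal_nth)
  also have "\<dots> = us ! l \<bullet> v"
    using assms(3) by simp
  also have "\<dots> = v \<bullet> us ! l"
    using comm_scalar_prod[OF c(1) assms(2)] .
  finally show ?thesis
    using minus_scalar_prod_distrib[OF assms(2) c(2) c(1)] by simp
qed

lemma onb_proj_mat_of_cols:
  assumes "orthonormal n us" "v \<in> carrier_vec n"
  shows "onb_proj n us *\<^sub>v v = mat_of_cols n us *\<^sub>v (Matrix.vec (length us) (\<lambda>l. us ! l \<bullet> v))"
proof (rule eq_vecI)
  fix i assume "i < dim_vec (mat_of_cols n us *\<^sub>v (Matrix.vec (length us) (\<lambda>l. us ! l \<bullet> v)))"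
  then have "i < n" by simp
  then show "(onb_proj n us *\<^sub>v v) $ i
      = (mat_of_cols n us *\<^sub>v (Matrix.vec (length us) (\<lambda>l. us ! l \<bullet> v))) $ i"
    using assms
    by (subst onb_proj_mult_index) (auto simp: scalar_prod_def atLeast0LessThan mat_of_cols_index mult_ac
        intro!: sum.cong)
qed (simp add: onb_proj_def)

text \<open>This is U^T U = 1. It yields both the linear independence of \<open>us\<close> and the
  invariance of their span under the projection.\<close>

lemma mat_of_cols_mult_coeff:
  assumes "orthonormal n us" "c \<in> carrier_vec (length us)" "l < length us"
  shows "us ! l \<bullet> (mat_of_cols n us *\<^sub>v c) = c $ l"
proof -
  have ul: "us ! l \<in> carrier_vec n" using orthonormal_carrier[OF assms(1,3)] .
  have "us ! l \<bullet> (mat_of_cols n us *\<^sub>v c) = (\<Sum>i<n. (us ! l) $ i * (\<Sum>m<length us. (us ! m) $ i * c $ m))"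
    using assms(2) by (simp add: scalar_prod_def atLeast0LessThan mat_of_cols_index)
  also have "\<dots> = (\<Sum>m<length us. \<Sum>i<n. (us ! l) $ i * ((us ! m) $ i * c $ m))"
    by (subst sum.swap) (simp add: sum_distrib_left)
  also have "\<dots> = (\<Sum>m<length us. (us ! l \<bullet> us ! m) * c $ m)"
    using carrier_vecD[OF orthonormal_carrier[OF assms(1)]]
    by (intro sum.cong refl)
      (simp add: scalar_prod_def atLeast0LessThan sum_distrib_left sum_distrib_right mult_ac)
  also have "\<dots> = (\<Sum>m<length us. if m = l then c $ m else 0)"
    using assms by (intro sum.cong) (auto simp: orthonormal_nth)
  finally show ?thesis using assms(3) by simp
qed

lemma onb_proj_fixes_span:
  assumes "orthonormal n us" "c \<in> carrier_vec (length us)"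
  shows "onb_proj n us *\<^sub>v (mat_of_cols n us *\<^sub>v c) = mat_of_cols n us *\<^sub>v c"
proof -
  have "mat_of_cols n us *\<^sub>v c \<in> carrier_vec n" using assms(2) by auto
  moreover have "Matrix.vec (length us) (\<lambda>l. us ! l \<bullet> (mat_of_cols n us *\<^sub>v c)) = c"
    using assms by (intro eq_vecI) (auto simp: mat_of_cols_mult_coeff)
  ultimately show ?thesis
    using onb_proj_mat_of_cols[OF assms(1)] by simp
qed

text \<open>Connects the explicit column spaces of the statement with spans, in which Gram-Schmidt
  is carried out.\<close>

lemma column_space_span:
  assumes "A \<in> carrier_mat n m"
  shows "column_space A = LinearCombinations.module.span class_ring (module_vec TYPE(real) n) (set (cols A))"
proof -
  interpret vec_space "TYPE(real)" n .
  show ?thesis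
    using col_space_eq[OF assms] assms by (auto simp: col_space_def column_space_def)
qed

lemma column_space_onb_proj:
  assumes "orthonormal n us"
  shows "column_space (onb_proj n us) = column_space (mat_of_cols n us)"
proof
  show "column_space (onb_proj n us) \<subseteq> column_space (mat_of_cols n us)"
    using onb_proj_mat_of_cols[OF assms] by (force simp: column_space_def onb_proj_def)
  show "column_space (mat_of_cols n us) \<subseteq> column_space (onb_proj n us)"
  proof
    fix y assume "y \<in> column_space (mat_of_cols n us)"
    then obtain c where c: "c \<in> carrier_vec (length us)" "y = mat_of_cols n us *\<^sub>v c"
      by (auto simp: column_space_def)
    moreover have "mat_of_cols n us *\<^sub>v c \<in> carrier_vec n" using c by auto
    ultimately show "y \<in> column_space (onb_proj n us)"
      using onb_proj_fixes_span[OF assms c(1)] 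
      by (auto simp: column_space_def onb_proj_def intro!: exI[of _ y])
  qed
qed

text \<open>The rank depends only on the span of the columns, which is the same for U U^T and for U;
  and U has independent columns because a vector in its kernel has all coordinates zero.\<close>

lemma rank_onb_proj:
  assumes "orthonormal n us"
  shows "vec_space.rank n (onb_proj n us) = length us"
proof -
  interpret vec_space "TYPE(real)" n .
  let ?U = "mat_of_cols n us"
  have U: "?U \<in> carrier_mat n (length us)" by simp
  have cu: "cols ?U = us"
    using assms by (simp add: orthonormal_def)
  \<comment> \<open>Linear dependence concerns the set of columns, so repetitions in the list are
    excluded separately.\<close>
  have dist: "distinct us"
  proof (clarsimp simp: distinct_conv_nth)
    fix i j assume "i < length us" "j < length us" "i \<noteq> j" "us ! i = us ! j"
    then show False
      using orthonormal_nth[OF assms, of i j] orthonormal_nth[OF assms, of i i] by simp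
  qed
  have "\<not> lin_dep (set us)"
  proof
    assume "lin_dep (set us)"
    then obtain v where v: "v \<in> carrier_vec (length us)" "v \<noteq> 0\<^sub>v (length us)" "?U *\<^sub>v v = 0\<^sub>v n"
      using lin_depE[OF U] cu dist by metis
    have "v $ l = 0" if "l < length us" for l
      using mat_of_cols_mult_coeff[OF assms v(1) that] v(3) orthonormal_carrier[OF assms that] by simp
    then have "v = 0\<^sub>v (length us)" using v(1) by (intro eq_vecI) auto
    then show False using v(2) by contradiction
  qed
  then have "rank ?U = length us"
    using lin_indpt_full_rank[OF U] cu dist by simp
  moreover have "span (set (cols (onb_proj n us))) = span (set (cols ?U))"
    using column_space_onb_proj[OF assms] column_space_span[OF onb_proj_carrier] column_space_span[OF U]
    by simp
  ultimately show ?thesis by (simp add: rank_def)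
qed

lemma is_orth_proj_onb:
  assumes "orthonormal n us"
  shows "is_orth_proj n (column_space (mat_of_cols n us)) (onb_proj n us)"
  unfolding is_orth_proj_def
proof (intro conjI ballI)
  fix v :: "real Matrix.vec" assume v: "v \<in> carrier_vec n"
  show "onb_proj n us *\<^sub>v v \<in> column_space (mat_of_cols n us)"
    using onb_proj_mat_of_cols[OF assms v] by (auto simp: column_space_def)
  fix w assume "w \<in> column_space (mat_of_cols n us)"
  then obtain c where c: "c \<in> carrier_vec (length us)" "w = mat_of_cols n us *\<^sub>v c"
    by (auto simp: column_space_def)
  then have w: "w \<in> carrier_vec n" by auto
  let ?r = "v - onb_proj n us *\<^sub>v v"
  have Pv: "onb_proj n us *\<^sub>v v \<in> carrier_vec n"
    by (rule mult_mat_vec_carrier[OF onb_proj_carrier v])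
  have r: "?r \<in> carrier_vec n" using v Pv by auto
  have "onb_proj n us *\<^sub>v w = w" using onb_proj_fixes_span[OF assms c(1)] c(2) by simp
  then have "?r \<bullet> w = (onb_proj n us *\<^sub>v w) \<bullet> ?r"
    using comm_scalar_prod[OF r w] by simp
  also have "\<dots> = (\<Sum>l<length us. (us ! l \<bullet> w) * (us ! l \<bullet> ?r))"
    by (rule scalar_prod_onb_proj[OF assms w r])
  also have "\<dots> = 0"
  proof (intro sum.neutral ballI)
    fix l assume "l \<in> {..<length us}"
    then have l: "l < length us" by simp
    then show "(us ! l \<bullet> w) * (us ! l \<bullet> ?r) = 0"
      using onb_proj_residual_orth[OF assms v l] comm_scalar_prod[OF orthonormal_carrier[OF assms l] r]
      by simp
  qed
  finally show "?r \<bullet> w = 0" .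
qed simp

text \<open>Since V is an arbitrary set of vectors, the difference p - q of two projections of v
  need not lie in V. Its square is expanded against p and q, which do lie in V.\<close>

lemma is_orth_proj_unique:
  assumes P: "is_orth_proj n V P" and Q: "is_orth_proj n V Q" and V: "V \<subseteq> carrier_vec n"
  shows "P = Q"
proof -
  have c: "P \<in> carrier_mat n n" "Q \<in> carrier_mat n n"
    using P Q by (auto simp: is_orth_proj_def)
  have eq: "P *\<^sub>v v = Q *\<^sub>v v" if v: "v \<in> carrier_vec n" for v
  proof -
    let ?p = "P *\<^sub>v v" and ?q = "Q *\<^sub>v v"
    have cc: "?p \<in> carrier_vec n" "?q \<in> carrier_vec n" using c v by auto
    have "?p \<in> V" "?q \<in> V" and z: "\<forall>w\<in>V. (v - ?p) \<bullet> w = 0" "\<forall>w\<in>V. (v - ?q) \<bullet> w = 0"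
      using P Q v by (auto simp: is_orth_proj_def)
    then have "(?p - ?q) \<bullet> w = 0" if "w \<in> V" for w
      using that z[THEN bspec, OF that] V cc v
        minus_scalar_prod_distrib[of v n ?p w] minus_scalar_prod_distrib[of v n ?q w]
        minus_scalar_prod_distrib[of ?p n ?q w] by auto
    then have "(?p - ?q) \<bullet> (?p - ?q) = 0"
      using \<open>?p \<in> V\<close> \<open>?q \<in> V\<close> cc scalar_prod_minus_distrib[of "?p - ?q" n ?p ?q] by auto
    then have "\<forall>i<n. (?p - ?q) $ i = 0"
      using cc c by (simp add: scalar_prod_def sum_nonneg_eq_0_iff)
    then show ?thesis using cc c by (intro eq_vecI) auto
  qed
  show ?thesis
  proof (rule eq_matI)
    fix i j assume "i < dim_row Q" "j < dim_col Q"
    then have "i < n" "j < n" using c by auto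
    then have "(P *\<^sub>v unit_vec n j) $ i = P $$ (i, j)" "(Q *\<^sub>v unit_vec n j) $ i = Q $$ (i, j)"
      using c by auto
    then show "P $$ (i, j) = Q $$ (i, j)" using eq[of "unit_vec n j"] by simp
  qed (use c in auto)
qed

lemma the_is_orth_proj:
  assumes "orthonormal n us" "V = column_space (mat_of_cols n us)"
  shows "(THE P. is_orth_proj n V P) = onb_proj n us"
proof (rule the_equality)
  show *: "is_orth_proj n V (onb_proj n us)"
    using is_orth_proj_onb assms by simp
  have "V \<subseteq> carrier_vec n"
    using assms(2) mult_mat_vec_carrier[OF mat_of_cols_carrier(1)] by (fastforce simp: column_space_def)
  then show "P = onb_proj n us" if "is_orth_proj n V P" for P
    using is_orth_proj_unique[OF that *] by simp
qed

text \<open>Gram-Schmidt with a prescribed start; a vector of \<open>ws\<close> whose residual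
  vanishes is dropped. It is used with an empty start for a basis of a model, with the unit vectors
  as \<open>ws\<close> for a completion to the whole space, and with a basis of a submodel as start
  for the direction gained by the larger model.\<close>

lemma orthonormal_extension:
  assumes "orthonormal n us" "set ws \<subseteq> carrier_vec n"
  shows "\<exists>vs. orthonormal n (us @ vs) \<and>
    LinearCombinations.module.span class_ring (module_vec TYPE(real) n) (set (us @ vs))
    = LinearCombinations.module.span class_ring (module_vec TYPE(real) n) (set us \<union> set ws)"
  using assms
proof (induction ws arbitrary: us)
  case Nil
  then show ?case by (intro exI[of _ "[]"]) simp
next
  case (Cons w ws)
  interpret vec_space "TYPE(real)" n .
  let ?P = "onb_proj n us"
  define r where "r = w - ?P *\<^sub>v w"
  have w: "w \<in> carrier_vec n" and ws: "set ws \<subseteq> carrier_vec n" using Cons.prems by auto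
  have us: "set us \<subseteq> carrier_vec n" using Cons.prems by (simp add: orthonormal_def)
  have Pw: "?P *\<^sub>v w \<in> carrier_vec n"
    by (rule mult_mat_vec_carrier[OF onb_proj_carrier w])
  have r: "r \<in> carrier_vec n" using w Pw by (auto simp: r_def)
  have "?P *\<^sub>v w \<in> column_space (mat_of_cols n us)"
    using is_orth_proj_onb[OF Cons.prems(1)] w by (simp add: is_orth_proj_def)
  then have Pw_span: "?P *\<^sub>v w \<in> span (set us)"
    using column_space_span[OF mat_of_cols_carrier(1), of n us] us by simp
  have w_eq: "w = r + ?P *\<^sub>v w" and r_eq: "r = w + (-1) \<cdot>\<^sub>v (?P *\<^sub>v w)"
    using carrier_vecD[OF w] carrier_vecD[OF Pw] by (intro eq_vecI, simp_all add: r_def)+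
  show ?case
  proof (cases "r = 0\<^sub>v n")
    case True
    then have "w = 0\<^sub>v n + ?P *\<^sub>v w" using w_eq by (rule subst)
    then have w_span: "w \<in> span (set us)" using Pw_span Pw by simp
    from Cons.IH[OF Cons.prems(1) ws] obtain vs where
      vs: "orthonormal n (us @ vs)" "span (set (us @ vs)) = span (set us \<union> set ws)" by blast
    have "span (set us \<union> set (w # ws)) = span (set us \<union> set ws)"
    proof
      have "w \<in> span (set us \<union> set ws)"
        using w_span span_is_monotone[of "set us" "set us \<union> set ws"] by auto
      then show "span (set us \<union> set (w # ws)) \<subseteq> span (set us \<union> set ws)"
        using us ws in_own_span[of "set us \<union> set ws"] by (intro span_subsetI) auto
    qed (intro span_is_monotone, auto)
    then show ?thesis using vs by auto
  next
    case False
    let ?s = "sqrt (r \<bullet> r)"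
    have "r \<bullet> r > 0"
    proof -
      obtain i where "i < n" "r $ i \<noteq> 0"
      proof (rule ccontr)
        assume "\<not> thesis"
        then have "\<forall>i<n. r $ i = 0" using that by blast
        then have "r = 0\<^sub>v n" using r by (intro eq_vecI) auto
        then show False using False by contradiction
      qed
      then show ?thesis
        unfolding scalar_prod_def using r
        by (intro sum_pos2[of _ i]) (auto simp: zero_less_mult_iff)
    qed
    then have s: "?s > 0" "?s * ?s = r \<bullet> r" by auto
    define u where "u = (1 / ?s) \<cdot>\<^sub>v r"
    have u: "u \<in> carrier_vec n" using r by (simp add: u_def)
    have ru: "r = ?s \<cdot>\<^sub>v u" using s by (simp add: u_def smult_smult_assoc)
    have "u \<bullet> u = 1"
      using r s by (simp add: u_def scalar_prod_smult_distrib[OF r])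
    moreover have "\<forall>z\<in>set us. z \<bullet> u = 0"
    proof
      fix z assume z: "z \<in> set us"
      then obtain l where l: "l < length us" "z = us ! l" by (metis in_set_conv_nth)
      have "z \<in> carrier_vec n" using z us by blast
      moreover from this have "z \<bullet> r = 0"
        using onb_proj_residual_orth[OF Cons.prems(1) w l(1), folded r_def l(2)]
          comm_scalar_prod[OF _ r, of z] by simp
      ultimately show "z \<bullet> u = 0"
        unfolding u_def using r by simp
    qed
    ultimately have on: "orthonormal n (us @ [u])"
      using Cons.prems(1) u by (auto simp: orthonormal_append_iff) (auto simp: orthonormal_def)
    from Cons.IH[OF on ws] obtain vs where
      vs: "orthonormal n ((us @ [u]) @ vs)"
          "span (set ((us @ [u]) @ vs)) = span (set (us @ [u]) \<union> set ws)" by blast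
    \<comment> \<open>Once the projection of w is known to lie in both spans, w and u are
      interchangeable generators: each is a combination of the other one and that
      projection.\<close>
    let ?A = "set us \<union> set (w # ws)" and ?B = "set (us @ [u]) \<union> set ws"
    have A: "?A \<subseteq> carrier_vec n" and B: "?B \<subseteq> carrier_vec n" using us u w ws by auto
    have PA: "?P *\<^sub>v w \<in> span ?A" "?P *\<^sub>v w \<in> span ?B"
      using Pw_span span_is_monotone[of "set us" ?A] span_is_monotone[of "set us" ?B] by auto
    have "w \<in> span ?A" "u \<in> span ?B" using in_own_span[OF A] in_own_span[OF B] by auto
    have "r \<in> span ?A"
      unfolding r_eq using \<open>w \<in> span ?A\<close> smult_in_span[OF A PA(1)] span_add1[OF A] by blast
    then have uA: "u \<in> span ?A" unfolding u_def by (rule smult_in_span[OF A])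
    have "?s \<cdot>\<^sub>v u \<in> span ?B" by (rule smult_in_span[OF B \<open>u \<in> span ?B\<close>])
    then have "r \<in> span ?B" by (simp flip: ru)
    then have "r + ?P *\<^sub>v w \<in> span ?B" using span_add1[OF B _ PA(2)] by blast
    then have wB: "w \<in> span ?B" by (simp flip: w_eq)
    have "span ?A = span ?B"
    proof
      show "span ?A \<subseteq> span ?B"
        using wB in_own_span[OF B] by (intro span_subsetI[OF B]) auto
      show "span ?B \<subseteq> span ?A"
        using uA in_own_span[OF A] by (intro span_subsetI[OF A]) auto
    qed
    then show ?thesis using vs by (intro exI[of _ "u # vs"]) simp
  qed
qed

section \<open>Linear forms of Gaussian errors\<close>

text \<open>The weight turns the density into a multiple of exp (- g^2), and g = y / sqrt 2 makes it
  standard normal again. The value is also the expectation of exp (- (Z + m)^2 / 2) for a standard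
  normal Z, the Laplace transform at 1/2 of a noncentral chi-square law.\<close>

lemma std_normal_weighted_char:
  "(CLINT g|std_normal_distribution. iexp (g * m) * complex_of_real (exp (- g\<^sup>2 / 2)))
     = complex_of_real (exp (- m\<^sup>2 / 4) / sqrt 2)"
proof -
  have "(CLINT g|std_normal_distribution. iexp (g * m) * complex_of_real (exp (- g\<^sup>2 / 2)))
      = (CLINT g|lborel. std_normal_density g *\<^sub>R (iexp (g * m) * complex_of_real (exp (- g\<^sup>2 / 2))))"
    by (subst integral_density) (auto simp: normal_density_nonneg)
  also have "\<dots> = (1 / sqrt 2) *\<^sub>R (CLINT y|lborel. std_normal_density (0 + 1 / sqrt 2 * y) *\<^sub>R
      (iexp ((0 + 1 / sqrt 2 * y) * m) * complex_of_real (exp (- (0 + 1 / sqrt 2 * y)\<^sup>2 / 2))))"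
    by (subst lborel_integral_real_affine[of "1 / sqrt 2" _ 0]) auto
  also have "(\<lambda>y::real. std_normal_density (0 + 1 / sqrt 2 * y) *\<^sub>R
      (iexp ((0 + 1 / sqrt 2 * y) * m) * complex_of_real (exp (- (0 + 1 / sqrt 2 * y)\<^sup>2 / 2))))
      = (\<lambda>y. std_normal_density y *\<^sub>R iexp (m / sqrt 2 * y))"
  proof
    fix y :: real
    have "exp (- (y / sqrt 2)\<^sup>2 / 2) * exp (- (y / sqrt 2)\<^sup>2 / 2) = exp (- y\<^sup>2 / 2)"
      by (simp add: exp_add[symmetric] power_divide)
    then have "std_normal_density (y / sqrt 2) * exp (- (y / sqrt 2)\<^sup>2 / 2) = std_normal_density y"
      by (simp add: std_normal_density_def)
    then show "std_normal_density (0 + 1 / sqrt 2 * y) *\<^sub>R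
      (iexp ((0 + 1 / sqrt 2 * y) * m) * complex_of_real (exp (- (0 + 1 / sqrt 2 * y)\<^sup>2 / 2)))
      = std_normal_density y *\<^sub>R iexp (m / sqrt 2 * y)"
      by (simp add: scaleR_conv_of_real mult_ac flip: of_real_mult)
  qed
  also have "(CLINT y|lborel. std_normal_density y *\<^sub>R iexp (m / sqrt 2 * y))
      = char std_normal_distribution (m / sqrt 2)"
    unfolding char_def by (subst integral_density) (auto simp: normal_density_nonneg)
  also have "(1 / sqrt 2) *\<^sub>R char std_normal_distribution (m / sqrt 2)
      = complex_of_real (exp (- m\<^sup>2 / 4) / sqrt 2)"
    by (simp add: char_std_normal_distribution scaleR_conv_of_real power_divide)
  finally show ?thesis .
qed

section \<open>Exponential moments and tails of linear and quadratic forms\<close>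

context prob_space
begin

lemma std_normal_char:
  assumes "distributed M lborel Z std_normal_density"
  shows "(CLINT \<omega>|M. iexp (t * Z \<omega>)) = complex_of_real (exp (- t\<^sup>2 / 2))"
proof -
  have [measurable]: "Z \<in> borel_measurable M"
    using assms by (auto simp: distributed_def)
  have "std_normal_distribution = distr M borel Z"
    using assms distr_cong[of M M lborel borel Z Z] by (auto simp: distributed_def)
  moreover have "char (distr M borel Z) t = (CLINT \<omega>|M. iexp (t * Z \<omega>))"
    unfolding char_def by (subst integral_distr) auto
  ultimately show ?thesis
    using char_std_normal_distribution by (metis minus_divide_left)
qed

lemma std_normal_mgf:
  assumes "distributed M lborel Z std_normal_density"
  shows "integrable M (\<lambda>\<omega>. exp (t * Z \<omega>))" "expectation (\<lambda>\<omega>. exp (t * Z \<omega>)) = exp (t\<^sup>2 / 2)"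
proof -
  \<comment> \<open>Completing the square: tilting by exp (t x) moves the mean to t.\<close>
  have eq: "std_normal_density x * exp (t * x) = exp (t\<^sup>2 / 2) * normal_density t 1 x" for x
    by (simp add: normal_density_def exp_add[symmetric] power2_eq_square algebra_simps diff_divide_distrib add_divide_distrib)
  show "integrable M (\<lambda>\<omega>. exp (t * Z \<omega>))"
    using distributed_integrable[OF assms, of "\<lambda>x. exp (t * x)"]
    by (simp add: eq normal_density_nonneg)
  show "expectation (\<lambda>\<omega>. exp (t * Z \<omega>)) = exp (t\<^sup>2 / 2)"
    using distributed_integral[OF assms, of "\<lambda>x. exp (t * x)"]
    by (simp add: eq normal_density_nonneg)
qed

context
  fixes Z :: "nat \<Rightarrow> 'a \<Rightarrow> real"
  assumes indep: "indep_vars (\<lambda>_. borel) Z UNIV"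
    and normal: "\<And>i. distributed M lborel (Z i) std_normal_density"
begin

lemma Z_measurable [measurable]: "Z i \<in> borel_measurable M"
  using normal[of i] by (auto simp: distributed_def)

lemma linear_form_mgf:
  shows "integrable M (\<lambda>\<omega>. exp (t * (\<Sum>i<n. h i * Z i \<omega>)))"
    and "expectation (\<lambda>\<omega>. exp (t * (\<Sum>i<n. h i * Z i \<omega>))) = exp (t\<^sup>2 * (\<Sum>i<n. (h i)\<^sup>2) / 2)"
proof -
  have eq: "(\<lambda>\<omega>. exp (t * (\<Sum>i<n. h i * Z i \<omega>))) = (\<lambda>\<omega>. \<Prod>i<n. exp (t * h i * Z i \<omega>))"
    by (simp add: exp_sum sum_distrib_left mult_ac)
  have ind: "indep_vars (\<lambda>_. borel) (\<lambda>i \<omega>. exp (t * h i * Z i \<omega>)) {..<n}"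
    by (rule indep_vars_compose2[where X = Z and M' = "\<lambda>_. borel"])
      (auto intro: indep_vars_subset[OF indep])
  note int = std_normal_mgf[OF normal]
  show "integrable M (\<lambda>\<omega>. exp (t * (\<Sum>i<n. h i * Z i \<omega>)))"
    unfolding eq by (intro indep_vars_integrable ind int) auto
  have "expectation (\<lambda>\<omega>. \<Prod>i<n. exp (t * h i * Z i \<omega>)) = (\<Prod>i<n. exp ((t * h i)\<^sup>2 / 2))"
    by (subst indep_vars_lebesgue_integral[OF _ ind]) (auto simp: int)
  also have "\<dots> = exp (t\<^sup>2 * (\<Sum>i<n. (h i)\<^sup>2) / 2)"
    by (simp add: exp_sum[symmetric] sum_distrib_left sum_divide_distrib power_mult_distrib)
  finally show "expectation (\<lambda>\<omega>. exp (t * (\<Sum>i<n. h i * Z i \<omega>))) = exp (t\<^sup>2 * (\<Sum>i<n. (h i)\<^sup>2) / 2)"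
    by (simp add: eq)
qed

text \<open>Chernoff's bound; for a coefficient vector of norm one the optimal parameter is s
  itself.\<close>

lemma linear_form_tail_one_sided:
  assumes "(\<Sum>i<n. (h i)\<^sup>2) = 1" "s \<ge> 0"
  shows "prob {\<omega> \<in> space M. (\<Sum>i<n. h i * Z i \<omega>) \<ge> s} \<le> exp (- s\<^sup>2 / 2)"
proof -
  have "{\<omega> \<in> space M. (\<Sum>i<n. h i * Z i \<omega>) \<ge> s}
      \<subseteq> {\<omega> \<in> space M. exp (s * (\<Sum>i<n. h i * Z i \<omega>)) \<ge> exp (s * s)}"
    using assms(2) by (auto intro: mult_left_mono)
  then have "prob {\<omega> \<in> space M. (\<Sum>i<n. h i * Z i \<omega>) \<ge> s}
      \<le> prob {\<omega> \<in> space M. exp (s * (\<Sum>i<n. h i * Z i \<omega>)) \<ge> exp (s * s)}"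
    by (rule finite_measure_mono) measurable
  also have "\<dots> \<le> expectation (\<lambda>\<omega>. exp (s * (\<Sum>i<n. h i * Z i \<omega>))) / exp (s * s)"
    by (rule integral_Markov_inequality_measure[where A = "{}"]) (auto intro: linear_form_mgf)
  also have "\<dots> = exp (- s\<^sup>2 / 2)"
    using assms(1) by (simp add: linear_form_mgf exp_diff[symmetric] power2_eq_square)
  finally show ?thesis .
qed

lemma linear_form_tail:
  assumes "(\<Sum>i<n. (h i)\<^sup>2) = 1" "s \<ge> 0"
  shows "prob {\<omega> \<in> space M. (\<Sum>i<n. h i * Z i \<omega>)\<^sup>2 \<ge> s} \<le> 2 * exp (- s / 2)"
proof -
  let ?r = "sqrt s"
  let ?A = "{\<omega> \<in> space M. (\<Sum>i<n. h i * Z i \<omega>) \<ge> ?r}"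
  let ?B = "{\<omega> \<in> space M. (\<Sum>i<n. - h i * Z i \<omega>) \<ge> ?r}"
  have "{\<omega> \<in> space M. (\<Sum>i<n. h i * Z i \<omega>)\<^sup>2 \<ge> s} \<subseteq> ?A \<union> ?B"
  proof safe
    fix \<omega> assume "(\<Sum>i<n. h i * Z i \<omega>)\<^sup>2 \<ge> s" "\<not> ?r \<le> (\<Sum>i<n. - h i * Z i \<omega>)"
    then have "?r \<le> \<bar>\<Sum>i<n. h i * Z i \<omega>\<bar>"
      by (metis real_sqrt_abs real_sqrt_le_iff)
    then show "?r \<le> (\<Sum>i<n. h i * Z i \<omega>)"
      using \<open>\<not> ?r \<le> _\<close> by (auto simp: sum_negf abs_if split: if_splits)
  qed
  then have "prob {\<omega> \<in> space M. (\<Sum>i<n. h i * Z i \<omega>)\<^sup>2 \<ge> s} \<le> prob (?A \<union> ?B)"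
    by (rule finite_measure_mono) measurable
  also have "\<dots> \<le> prob ?A + prob ?B"
    by (intro measure_Un_le) measurable
  also have "\<dots> \<le> exp (- ?r\<^sup>2 / 2) + exp (- ?r\<^sup>2 / 2)"
    using assms by (intro add_mono linear_form_tail_one_sided) auto
  finally show ?thesis using assms(2) by simp
qed

lemma linear_form_char:
  "(CLINT \<omega>|M. iexp (\<Sum>i<n. h i * Z i \<omega>)) = complex_of_real (exp (- (\<Sum>i<n. (h i)\<^sup>2) / 2))"
proof -
  have ind: "indep_vars (\<lambda>_. borel) (\<lambda>i \<omega>. iexp (h i * Z i \<omega>)) {..<n}"
    by (rule indep_vars_compose2[where X = Z and M' = "\<lambda>_. borel"])
      (auto intro: indep_vars_subset[OF indep])
  have "(CLINT \<omega>|M. iexp (\<Sum>i<n. h i * Z i \<omega>)) = (CLINT \<omega>|M. \<Prod>i<n. iexp (h i * Z i \<omega>))"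
    by (simp add: exp_sum[symmetric] sum_distrib_left)
  also have "\<dots> = (\<Prod>i<n. complex_of_real (exp (- (h i)\<^sup>2 / 2)))"
    by (subst indep_vars_lebesgue_integral[OF _ ind])
      (auto simp: std_normal_char[OF normal] intro!: integrable_iexp simp del: of_real_mult)
  also have "\<dots> = complex_of_real (exp (- (\<Sum>i<n. (h i)\<^sup>2) / 2))"
    by (simp add: exp_sum[symmetric] sum_negf sum_divide_distrib flip: of_real_prod)
  finally show ?thesis .
qed

text \<open>Each factor exp (- X^2 / 2) is written as the characteristic function at X of an auxiliary standard
  normal variable g. After exchanging the two expectations the errors enter only through a linear
  form whose coefficient vector has squared norm equal to the sum of the g^2. This replaces
  the rotation invariance of the Gaussian law.\<close>

lemma exp_sum_squares_expectation:
  fixes U :: "nat \<Rightarrow> nat \<Rightarrow> real"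
  assumes on: "\<And>l l'. l < q \<Longrightarrow> l' < q \<Longrightarrow> (\<Sum>i<n. U l i * U l' i) = (if l = l' then 1 else 0)"
  shows "expectation (\<lambda>\<omega>. exp (- (\<Sum>l<q. ((\<Sum>i<n. U l i * Z i \<omega>) + m l)\<^sup>2) / 2))
    = (\<Prod>l<q. exp (- (m l)\<^sup>2 / 4) / sqrt 2)"
proof -
  define N where "N = Pi\<^sub>M {..<q} (\<lambda>_. std_normal_distribution)"
  define X where "X l \<omega> = (\<Sum>i<n. U l i * Z i \<omega>) + m l" for l \<omega>
  define F where "F \<omega> g = (\<Prod>l<q. iexp (g l * X l \<omega>))" for \<omega> and g :: "nat \<Rightarrow> real"
  interpret SN: prob_space std_normal_distribution
    by (rule prob_space_normal_density) simp
  interpret PS: product_prob_space "\<lambda>_. std_normal_distribution" "{..<q}" ..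
  interpret N: prob_space N
    unfolding N_def by (rule PS.prob_space_axioms)
  interpret MN: pair_prob_space M N ..
  have X[measurable]: "X l \<in> borel_measurable M" for l
    unfolding X_def by measurable
  have [measurable]: "(\<lambda>g. g l) \<in> borel_measurable N" if "l \<in> {..<q}" for l
    using measurable_component_singleton[OF that, of "\<lambda>_. std_normal_distribution"]
    unfolding N_def by simp
  have F_meas: "case_prod F \<in> borel_measurable (M \<Otimes>\<^sub>M N)"
    unfolding F_def case_prod_beta by measurable
  have F_norm: "norm (F \<omega> g) = 1" for \<omega> g
    unfolding F_def prod_norm[symmetric] by simp
  \<comment> \<open>F has modulus one on a product of probability spaces, which justifies
    Fubini.\<close>
  have F_int: "integrable (M \<Otimes>\<^sub>M N) (case_prod F)"
    by (rule MN.P.integrable_const_bound[where B = 1]) (use F_meas F_norm in auto)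
  have inner1: "(CLINT g|N. F \<omega> g) = complex_of_real (exp (- (\<Sum>l<q. (X l \<omega>)\<^sup>2) / 2))" for \<omega>
  proof -
    have int: "integrable std_normal_distribution (\<lambda>x. iexp (x * X l \<omega>))" for l
      by (rule SN.integrable_iexp) auto
    have "(CLINT g|N. F \<omega> g) = (\<Prod>l<q. CLINT x|std_normal_distribution. iexp (x * X l \<omega>))"
      unfolding F_def N_def by (rule PS.product_integral_prod) (auto simp: int simp del: of_real_mult)
    also have "\<dots> = (\<Prod>l<q. char std_normal_distribution (X l \<omega>))"
      by (simp add: char_def mult.commute)
    also have "\<dots> = complex_of_real (exp (- (\<Sum>l<q. (X l \<omega>)\<^sup>2) / 2))"
      by (simp add: char_std_normal_distribution exp_sum[symmetric] sum_negf sum_divide_distrib flip: of_real_prod)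
    finally show ?thesis .
  qed
  have inner2: "(CLINT \<omega>|M. F \<omega> g) = (\<Prod>l<q. iexp (g l * m l) * complex_of_real (exp (- (g l)\<^sup>2 / 2)))" for g
  proof -
    define h where "h i = (\<Sum>l<q. g l * U l i)" for i
    \<comment> \<open>The place where orthonormality enters: U^T g has the norm of g, so the result
      factors over l again.\<close>
    have hn: "(\<Sum>i<n. (h i)\<^sup>2) = (\<Sum>l<q. (g l)\<^sup>2)"
    proof -
      have "(\<Sum>i<n. (h i)\<^sup>2) = (\<Sum>i<n. \<Sum>l<q. \<Sum>l'<q. g l * g l' * (U l i * U l' i))"
        by (simp add: h_def power2_eq_square sum_product mult_ac)
      also have "\<dots> = (\<Sum>l<q. \<Sum>i<n. \<Sum>l'<q. g l * g l' * (U l i * U l' i))"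
        by (rule sum.swap)
      also have "\<dots> = (\<Sum>l<q. \<Sum>l'<q. \<Sum>i<n. g l * g l' * (U l i * U l' i))"
        by (intro sum.cong refl sum.swap)
      also have "\<dots> = (\<Sum>l<q. \<Sum>l'<q. g l * g l' * (if l = l' then 1 else 0))"
        by (intro sum.cong refl) (simp add: sum_distrib_left[symmetric] on)
      also have "\<dots> = (\<Sum>l<q. (g l)\<^sup>2)"
        by (simp add: if_distrib power2_eq_square cong: if_cong)
      finally show ?thesis .
    qed
    have lin: "(\<Sum>l<q. g l * X l \<omega>) = (\<Sum>i<n. h i * Z i \<omega>) + (\<Sum>l<q. g l * m l)" for \<omega>
    proof -
      have "(\<Sum>l<q. g l * X l \<omega>) = (\<Sum>l<q. \<Sum>i<n. g l * U l i * Z i \<omega>) + (\<Sum>l<q. g l * m l)"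
        by (simp add: X_def distrib_left sum.distrib sum_distrib_left mult_ac)
      also have "(\<Sum>l<q. \<Sum>i<n. g l * U l i * Z i \<omega>) = (\<Sum>i<n. h i * Z i \<omega>)"
        by (subst sum.swap) (simp add: h_def sum_distrib_right)
      finally show ?thesis .
    qed
    have "F \<omega> g = iexp (\<Sum>i<n. h i * Z i \<omega>) * iexp (\<Sum>l<q. g l * m l)" for \<omega>
    proof -
      have "F \<omega> g = iexp (\<Sum>l<q. g l * X l \<omega>)"
        by (simp add: F_def exp_sum[symmetric] sum_distrib_left)
      then show ?thesis unfolding lin by (simp add: exp_add[symmetric] distrib_left)
    qed
    then have "(CLINT \<omega>|M. F \<omega> g)
        = complex_of_real (exp (- (\<Sum>l<q. (g l)\<^sup>2) / 2)) * iexp (\<Sum>l<q. g l * m l)"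
      by (simp add: linear_form_char hn del: of_real_mult of_real_sum)
    also have "complex_of_real (exp (- (\<Sum>l<q. (g l)\<^sup>2) / 2))
        = (\<Prod>l<q. complex_of_real (exp (- (g l)\<^sup>2 / 2)))"
      by (simp add: exp_sum[symmetric] sum_negf sum_divide_distrib flip: of_real_prod)
    also have "iexp (\<Sum>l<q. g l * m l) = (\<Prod>l<q. iexp (g l * m l))"
      by (simp add: exp_sum[symmetric] sum_distrib_left)
    finally show ?thesis by (simp add: prod.distrib mult.commute)
  qed
  have int2: "integrable std_normal_distribution (\<lambda>x. iexp (x * m l) * complex_of_real (exp (- x\<^sup>2 / 2)))" for l
    by (rule SN.integrable_const_bound[where B = 1]) (auto simp: norm_mult)
  have "complex_of_real (expectation (\<lambda>\<omega>. exp (- (\<Sum>l<q. (X l \<omega>)\<^sup>2) / 2))) = (CLINT \<omega>|M. CLINT g|N. F \<omega> g)"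
    unfolding inner1 by (rule integral_complex_of_real[symmetric])
  also have "\<dots> = (CLINT g|N. CLINT \<omega>|M. F \<omega> g)"
    using MN.Fubini_integral[OF F_int] by simp
  also have "\<dots> = (\<Prod>l<q. CLINT x|std_normal_distribution. iexp (x * m l) * complex_of_real (exp (- x\<^sup>2 / 2)))"
    unfolding inner2 N_def by (rule PS.product_integral_prod[OF finite_lessThan int2])
  also have "\<dots> = complex_of_real (\<Prod>l<q. exp (- (m l)\<^sup>2 / 4) / sqrt 2)"
    unfolding std_normal_weighted_char by simp
  finally show ?thesis by (simp only: of_real_eq_iff X_def)
qed

text \<open>Markov's inequality for exp (- S / 2). The threshold, a quarter of the mean of S, costs
  exp ((q + mu) / 8) with mu the sum of the m^2, while each coordinate contributes exp (- m^2 / 4) /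
  sqrt 2. The costs in mu cancel and the exponent - q / 4 + q / 8 remains.\<close>

lemma sum_squares_lower_tail:
  fixes U :: "nat \<Rightarrow> nat \<Rightarrow> real"
  assumes on: "\<And>l l'. l < q \<Longrightarrow> l' < q \<Longrightarrow> (\<Sum>i<n. U l i * U l' i) = (if l = l' then 1 else 0)"
  shows "prob {\<omega> \<in> space M. (\<Sum>l<q. ((\<Sum>i<n. U l i * Z i \<omega>) + m l)\<^sup>2) \<le> (real q + (\<Sum>l<q. (m l)\<^sup>2)) / 4}
    \<le> exp (- real q / 8)"
proof -
  define S where "S \<omega> = (\<Sum>l<q. ((\<Sum>i<n. U l i * Z i \<omega>) + m l)\<^sup>2)" for \<omega>
  define \<mu> where "\<mu> = (\<Sum>l<q. (m l)\<^sup>2)"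
  have [measurable]: "S \<in> borel_measurable M" unfolding S_def by measurable
  have S0: "S \<omega> \<ge> 0" for \<omega> by (simp add: S_def sum_nonneg)
  let ?c = "exp (- ((real q + \<mu>) / 8))"
  have "prob {\<omega> \<in> space M. S \<omega> \<le> (real q + \<mu>) / 4} = prob {\<omega> \<in> space M. exp (- S \<omega> / 2) \<ge> ?c}"
    by (intro arg_cong[where f = prob]) auto
  also have "\<dots> \<le> expectation (\<lambda>\<omega>. exp (- S \<omega> / 2)) / ?c"
    by (rule integral_Markov_inequality_measure[where A = "{}"])
      (auto intro!: integrable_const_bound[where B = 1] simp: S0)
  also have "expectation (\<lambda>\<omega>. exp (- S \<omega> / 2)) = (\<Prod>l<q. exp (- (m l)\<^sup>2 / 4) / sqrt 2)"
    unfolding S_def by (rule exp_sum_squares_expectation[OF on])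
  \<comment> \<open>Half of the decay in m is kept, exactly what the threshold consumes. The bound 1
    / sqrt 2 <= exp (- 1 / 4) holds because ln 2 / 2 >= 1/3.\<close>
  also have "\<dots> \<le> (\<Prod>l<q. exp (- (m l)\<^sup>2 / 8) * exp (- 1 / 4))"
  proof (rule prod_mono, intro conjI)
    fix l
    have "exp (1 / 4 :: real) \<le> exp (ln (sqrt 2))"
      using ln2_ge_two_thirds by (simp add: ln_sqrt)
    then have "1 / sqrt 2 \<le> exp (- 1 / 4)"
      by (simp add: exp_minus inverse_eq_divide frac_le)
    then have "exp (- (m l)\<^sup>2 / 4) * (1 / sqrt 2) \<le> exp (- (m l)\<^sup>2 / 8) * exp (- 1 / 4)"
      by (intro mult_mono) auto
    then show "exp (- (m l)\<^sup>2 / 4) / sqrt 2 \<le> exp (- (m l)\<^sup>2 / 8) * exp (- 1 / 4)" by simp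
  qed auto
  also have "\<dots> = exp (- \<mu> / 8 - real q / 4)"
  proof -
    have "(\<Sum>l<q. - (m l)\<^sup>2 / 8 + - 1 / 4) = - \<mu> / 8 - real q / 4"
      by (simp add: sum.distrib \<mu>_def sum_subtractf sum_negf sum_divide_distrib)
    then show ?thesis by (simp only: exp_add[symmetric] exp_sum[symmetric] finite_lessThan)
  qed
  finally have "prob {\<omega> \<in> space M. S \<omega> \<le> (real q + \<mu>) / 4} \<le> exp (- \<mu> / 8 - real q / 4) / ?c"
    by (simp add: divide_right_mono)
  also have "\<dots> = exp (- real q / 8)"
    by (simp add: exp_diff[symmetric] add_divide_distrib)
  finally show ?thesis by (simp add: S_def \<mu>_def)
qed

end

end

section \<open>Projections of candidate models\<close>

lemma vnorm_power2: "(vnorm v)\<^sup>2 = v \<bullet> v"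
  by (simp add: vnorm_def scalar_prod_def sum_nonneg)

lemma residual_onb_proj:
  assumes "orthonormal n us" "v \<in> carrier_vec n"
  shows "(vnorm (v - onb_proj n us *\<^sub>v v))\<^sup>2 = v \<bullet> v - (\<Sum>l<length us. (us ! l \<bullet> v)\<^sup>2)"
proof -
  let ?p = "onb_proj n us *\<^sub>v v"
  have p: "?p \<in> carrier_vec n" using assms(2) by simp
  have "?p \<in> column_space (mat_of_cols n us)"
    and "\<forall>w\<in>column_space (mat_of_cols n us). (v - ?p) \<bullet> w = 0"
    using is_orth_proj_onb[OF assms(1)] assms(2) by (auto simp: is_orth_proj_def)
  then have "(v - ?p) \<bullet> ?p = 0" by blast
  moreover have "(v - ?p) \<bullet> (v - ?p) = (v - ?p) \<bullet> v - (v - ?p) \<bullet> ?p"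
    using assms(2) p by (intro scalar_prod_minus_distrib) auto
  moreover have "(v - ?p) \<bullet> v = v \<bullet> v - ?p \<bullet> v"
    using minus_scalar_prod_distrib[OF assms(2) p assms(2)] .
  moreover have "?p \<bullet> v = (\<Sum>l<length us. (us ! l \<bullet> v)\<^sup>2)"
    using scalar_prod_onb_proj[OF assms assms(2)] by (simp add: power2_eq_square)
  ultimately show ?thesis by (simp add: vnorm_power2)
qed

text \<open>By Parseval the residual is the sum of the squared coordinates along the added vectors.
  Their number gives the degrees of freedom n - r.\<close>

lemma orthonormal_completion:
  assumes us: "orthonormal n us"
  obtains vs where "orthonormal n vs" "length us + length vs = n"
    "\<And>v. v \<in> carrier_vec n \<Longrightarrow>
       (vnorm (v - onb_proj n us *\<^sub>v v))\<^sup>2 = (\<Sum>l<length vs. (vs ! l \<bullet> v)\<^sup>2)"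
proof -
  interpret vec_space "TYPE(real)" n .
  obtain vs where on: "orthonormal n (us @ vs)"
    and sp: "span (set (us @ vs)) = span (set us \<union> set (unit_vecs n))"
    using orthonormal_extension[OF us, of "unit_vecs n"] unit_vecs_carrier by blast
  have c: "set (us @ vs) \<subseteq> carrier_vec n" using on by (simp add: orthonormal_def)
  have "carrier_vec n \<subseteq> span (set (us @ vs))"
    unfolding sp
    using span_is_monotone[of "set (unit_vecs n)" "set us \<union> set (unit_vecs n)"]
    by (simp add: span_unit_vecs_is_carrier)
  then have full: "carrier_vec n \<subseteq> column_space (mat_of_cols n (us @ vs))"
    using column_space_span[OF mat_of_cols_carrier(1), of n "us @ vs"] c by simp
  have parseval: "v \<bullet> v = (\<Sum>l<length (us @ vs). ((us @ vs) ! l \<bullet> v)\<^sup>2)" if v: "v \<in> carrier_vec n" for v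
  proof -
    let ?r = "v - onb_proj n (us @ vs) *\<^sub>v v"
    have "?r \<in> column_space (mat_of_cols n (us @ vs))"
      using full v by (intro subsetD[OF full]) simp
    then have "?r \<bullet> ?r = 0"
      using is_orth_proj_onb[OF on] v by (auto simp: is_orth_proj_def)
    then show ?thesis
      using residual_onb_proj[OF on v] by (simp add: vnorm_power2)
  qed
  have list: "(\<Sum>l<length ws. (ws ! l \<bullet> v)\<^sup>2) = (\<Sum>w\<leftarrow>ws. (w \<bullet> v)\<^sup>2)" for ws and v :: "real Matrix.vec"
    by (simp add: sum_list_sum_nth atLeast0LessThan)
  have split: "(\<Sum>l<length (us @ vs). ((us @ vs) ! l \<bullet> v)\<^sup>2)
      = (\<Sum>l<length us. (us ! l \<bullet> v)\<^sup>2) + (\<Sum>l<length vs. (vs ! l \<bullet> v)\<^sup>2)" for v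
    unfolding list by simp
  \<comment> \<open>The trace of the identity in two ways: summing Parseval over the unit vectors
    gives n, summing the norms of the basis vectors gives their number.\<close>
  have "real (length (us @ vs)) = (\<Sum>l<length (us @ vs). (us @ vs) ! l \<bullet> (us @ vs) ! l)"
    using orthonormal_nth[OF on] by simp
  also have "\<dots> = (\<Sum>l<length (us @ vs). \<Sum>i<n. ((us @ vs) ! l $ i)\<^sup>2)"
    using carrier_vecD[OF orthonormal_carrier[OF on]]
    by (intro sum.cong refl) (simp add: scalar_prod_def atLeast0LessThan power2_eq_square)
  also have "\<dots> = (\<Sum>i<n. \<Sum>l<length (us @ vs). ((us @ vs) ! l \<bullet> unit_vec n i)\<^sup>2)"
    by (subst sum.swap) (simp add: orthonormal_carrier[OF on])
  also have "\<dots> = (\<Sum>i<n. unit_vec n i \<bullet> unit_vec n i)"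
    by (intro sum.cong refl parseval[symmetric]) simp
  also have "\<dots> = real n" by simp
  finally have "length us + length vs = n" by simp
  then show thesis
    using that[of vs] on residual_onb_proj[OF us] parseval split by (simp add: orthonormal_append_iff)
qed

section \<open>Bases of models and submodels\<close>

lemma design_matrix_carrier: "design_matrix x n \<phi> \<in> carrier_mat n (length \<phi>)"
  by (simp add: design_matrix_def)

lemma column_space_mono:
  assumes "model_family \<phi> \<subseteq> model_family \<psi>"
  shows "column_space (design_matrix x n \<phi>) \<subseteq> column_space (design_matrix x n \<psi>)"
proof
  fix y assume "y \<in> column_space (design_matrix x n \<phi>)"
  then obtain c where c: "c \<in> carrier_vec (length \<phi>)" "y = design_matrix x n \<phi> *\<^sub>v c"
    by (auto simp: column_space_def design_matrix_def)
  have "(\<lambda>z. \<Sum>l<length \<phi>. c $ l * (\<phi> ! l) z) \<in> model_family \<phi>"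
    by (auto simp: model_family_def intro!: exI[of _ "\<lambda>l. c $ l"])
  then obtain \<theta> where \<theta>: "(\<lambda>z. \<Sum>l<length \<phi>. c $ l * (\<phi> ! l) z) = (\<lambda>z. \<Sum>l<length \<psi>. \<theta> l * (\<psi> ! l) z)"
    using assms by (auto simp: model_family_def)
  have "y = design_matrix x n \<psi> *\<^sub>v Matrix.vec (length \<psi>) \<theta>"
    using c fun_cong[OF \<theta>]
    by (intro eq_vecI) (auto simp: design_matrix_def scalar_prod_def atLeast0LessThan mult.commute)
  then show "y \<in> column_space (design_matrix x n \<psi>)"
    by (auto simp: column_space_def design_matrix_def)
qed

lemma model_basis:
  obtains us where "orthonormal n us"
    "column_space (design_matrix x n \<phi>) = column_space (mat_of_cols n us)"
proof -
  interpret vec_space "TYPE(real)" n .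
  let ?A = "design_matrix x n \<phi>"
  have "orthonormal n []" by (simp add: orthonormal_def)
  moreover have "set (cols ?A) \<subseteq> carrier_vec n"
    using cols_dim[of ?A] design_matrix_carrier[of x n \<phi>] by auto
  ultimately obtain us where us: "orthonormal n us" "span (set us) = span (set (cols ?A))"
    using orthonormal_extension[of n "[]" "cols ?A"] by auto
  then have "set us \<subseteq> carrier_vec n" by (simp add: orthonormal_def)
  then have "column_space ?A = column_space (mat_of_cols n us)"
    using us(2) column_space_span[OF design_matrix_carrier]
      column_space_span[OF mat_of_cols_carrier(1), of n us] by simp
  then show thesis using that us(1) by blast
qed

lemma proj_rk_basis:
  assumes "orthonormal n us"
    and "column_space (design_matrix x n (reg k)) = column_space (mat_of_cols n us)"
  shows "proj x reg n k = onb_proj n us" "rk x reg n k = length us"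
proof -
  show "proj x reg n k = onb_proj n us"
    unfolding proj_def using the_is_orth_proj[OF assms(1)] assms(2) by simp
  then show "rk x reg n k = length us"
    by (simp add: rk_def rank_onb_proj[OF assms(1)])
qed

lemma proj_carrier [simp]: "proj x reg n k \<in> carrier_mat n n"
  by (metis model_basis proj_rk_basis(1) onb_proj_carrier)

lemma residual_basis:
  obtains vs where "orthonormal n vs" "rk x reg n k + length vs = n"
    "\<And>v. v \<in> carrier_vec n \<Longrightarrow>
       (vnorm (v - proj x reg n k *\<^sub>v v))\<^sup>2 = (\<Sum>l<length vs. (vs ! l \<bullet> v)\<^sup>2)"
proof -
  obtain us where us: "orthonormal n us"
    "column_space (design_matrix x n (reg k)) = column_space (mat_of_cols n us)"
    by (rule model_basis)
  show thesis
    using orthonormal_completion[OF us(1)] that by (metis proj_rk_basis[where x = x and reg = reg and k = k, OF us])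
qed

lemma obs_vec_carrier [simp]: "obs_vec x n g \<in> carrier_vec n"
  by (simp add: obs_vec_def)

lemma bias_eq: "bias x reg n g k = (vnorm (obs_vec x n g - proj x reg n k *\<^sub>v obs_vec x n g))\<^sup>2"
  unfolding bias_def
  by (subst minus_mult_distrib_mat_vec[of _ n n]) auto

lemma bias_nonneg: "bias x reg n g k \<ge> 0"
  by (simp add: bias_def)

text \<open>A basis of the submodel is extended to one of k, and since the ranks differ by one a
  single vector u is added. Both the signal in (N3') and the growth of the residual sum of squares
  are read off from this u.\<close>

lemma submodel_direction:
  assumes "k' \<in> S1 x reg n G k"
  obtains u where "u \<in> carrier_vec n" "u \<bullet> u = 1"
    "\<And>v. v \<in> carrier_vec n \<Longrightarrow> (vnorm ((proj x reg n k - proj x reg n k') *\<^sub>v v))\<^sup>2 = (u \<bullet> v)\<^sup>2"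
    "\<And>v. v \<in> carrier_vec n \<Longrightarrow> (vnorm (v - proj x reg n k' *\<^sub>v v))\<^sup>2
        = (vnorm (v - proj x reg n k *\<^sub>v v))\<^sup>2 + (u \<bullet> v)\<^sup>2"
proof -
  interpret vec_space "TYPE(real)" n .
  let ?A = "design_matrix x n (reg k)" and ?A' = "design_matrix x n (reg k')"
  have sub: "column_space ?A' \<subseteq> column_space ?A" and r: "rk x reg n k' + 1 = rk x reg n k"
    using assms column_space_mono[of "reg k'" "reg k"] by (auto simp: S1_def)
  obtain us where us: "orthonormal n us" "column_space ?A' = column_space (mat_of_cols n us)"
    by (rule model_basis)
  have cA: "set (cols ?A) \<subseteq> carrier_vec n"
    using cols_dim[of ?A] design_matrix_carrier[of x n "reg k"] by auto
  obtain vs where on: "orthonormal n (us @ vs)"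
    and sp: "span (set (us @ vs)) = span (set us \<union> set (cols ?A))"
    using orthonormal_extension[OF us(1) cA] by blast
  have cus: "set us \<subseteq> carrier_vec n" "set (us @ vs) \<subseteq> carrier_vec n"
    using us(1) on by (auto simp: orthonormal_def)
  have A: "column_space ?A = span (set (cols ?A))"
    by (rule column_space_span[OF design_matrix_carrier])
  have "set us \<subseteq> span (set us)" by (rule in_own_span[OF cus(1)])
  also have "\<dots> \<subseteq> span (set (cols ?A))"
    using sub us(2) A column_space_span[OF mat_of_cols_carrier(1), of n us] cus(1) by simp
  finally have "span (set us \<union> set (cols ?A)) = span (set (cols ?A))"
    using in_own_span[OF cA] by (intro subset_antisym span_subsetI[OF cA] span_is_monotone) auto
  then have "column_space ?A = column_space (mat_of_cols n (us @ vs))"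
    using A sp column_space_span[OF mat_of_cols_carrier(1), of n "us @ vs"] cus(2) by simp
  note k = proj_rk_basis[where x = x and reg = reg, OF on this]
  note k' = proj_rk_basis[where x = x and reg = reg, OF us]
  have "length vs = 1" using r k(2) k'(2) by simp
  then obtain u where u: "vs = [u]" by (auto simp: length_Suc_conv)
  have "orthonormal n vs" using on by (simp add: orthonormal_append_iff)
  then have uc: "u \<in> carrier_vec n" and u1: "u \<bullet> u = 1"
    using u orthonormal_carrier[of n vs 0] orthonormal_nth[of n vs 0 0] by auto
  have "(vnorm ((proj x reg n k - proj x reg n k') *\<^sub>v v))\<^sup>2 = (u \<bullet> v)\<^sup>2" if v: "v \<in> carrier_vec n" for v
  proof -
    have "(proj x reg n k - proj x reg n k') *\<^sub>v v = onb_proj n (us @ vs) *\<^sub>v v - onb_proj n us *\<^sub>v v"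
      unfolding k k' using v by (intro minus_mult_distrib_mat_vec) auto
    also have "\<dots> = (u \<bullet> v) \<cdot>\<^sub>v u"
      using uc v u onb_proj_mult_index[OF on v] onb_proj_mult_index[OF us(1) v]
      by (intro eq_vecI) (auto simp: nth_append simp del: index_mult_mat_vec)
    finally show ?thesis
      unfolding vnorm_power2 using uc u1 by (simp add: power2_eq_square)
  qed
  moreover have "(vnorm (v - proj x reg n k' *\<^sub>v v))\<^sup>2
        = (vnorm (v - proj x reg n k *\<^sub>v v))\<^sup>2 + (u \<bullet> v)\<^sup>2" if v: "v \<in> carrier_vec n" for v
    unfolding k k' residual_onb_proj[OF on v] residual_onb_proj[OF us(1) v] using u
    by (simp add: nth_append)
  ultimately show thesis using that uc u1 by blast
qed

section \<open>Signal and noise in the data\<close>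

definition noise_vec :: "(nat \<Rightarrow> 'w \<Rightarrow> real) \<Rightarrow> nat \<Rightarrow> 'w \<Rightarrow> real Matrix.vec" where
  "noise_vec \<epsilon> n \<omega> = Matrix.vec n (\<lambda>i. \<epsilon> i \<omega>)"

lemma noise_vec_carrier [simp]: "noise_vec \<epsilon> n \<omega> \<in> carrier_vec n"
  by (simp add: noise_vec_def)

lemma data_vec_carrier [simp]: "data_vec x \<epsilon> n g \<omega> \<in> carrier_vec n"
  by (simp add: data_vec_def)

lemma scalar_prod_noise_vec: "u \<bullet> noise_vec \<epsilon> n \<omega> = (\<Sum>i<n. u $ i * \<epsilon> i \<omega>)"
  by (simp add: noise_vec_def scalar_prod_def atLeast0LessThan)

lemma scalar_prod_data_vec:
  "u \<bullet> data_vec x \<epsilon> n g \<omega> = u \<bullet> obs_vec x n g + u \<bullet> noise_vec \<epsilon> n \<omega>"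
  by (simp add: data_vec_def obs_vec_def noise_vec_def scalar_prod_def distrib_left sum.distrib)

text \<open>The increase (u . Y)^2 is nonnegative and at most twice the squared signal plus twice
  the squared noise. This separates a deterministic term, governed by (N3'), from a random one with
  a Gaussian tail.\<close>

lemma submodel_residual_bounds:
  fixes x reg n k k' \<epsilon> g \<omega>
  defines "y \<equiv> data_vec x \<epsilon> n g \<omega>" and "D \<equiv> proj x reg n k - proj x reg n k'"
  assumes "k' \<in> S1 x reg n G k"
  shows "(vnorm (y - proj x reg n k *\<^sub>v y))\<^sup>2 \<le> (vnorm (y - proj x reg n k' *\<^sub>v y))\<^sup>2"
    and "(vnorm (y - proj x reg n k' *\<^sub>v y))\<^sup>2 \<le> (vnorm (y - proj x reg n k *\<^sub>v y))\<^sup>2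
      + 2 * (vnorm (D *\<^sub>v obs_vec x n g))\<^sup>2 + 2 * (vnorm (D *\<^sub>v noise_vec \<epsilon> n \<omega>))\<^sup>2"
proof -
  obtain u where u: "u \<in> carrier_vec n"
    "\<And>v. v \<in> carrier_vec n \<Longrightarrow> (vnorm (D *\<^sub>v v))\<^sup>2 = (u \<bullet> v)\<^sup>2"
    "\<And>v. v \<in> carrier_vec n \<Longrightarrow> (vnorm (v - proj x reg n k' *\<^sub>v v))\<^sup>2
        = (vnorm (v - proj x reg n k *\<^sub>v v))\<^sup>2 + (u \<bullet> v)\<^sup>2"
    using submodel_direction[OF assms(3)] unfolding D_def by metis
  have y: "y \<in> carrier_vec n" by (simp add: y_def)
  show "(vnorm (y - proj x reg n k *\<^sub>v y))\<^sup>2 \<le> (vnorm (y - proj x reg n k' *\<^sub>v y))\<^sup>2"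
    by (simp add: u(3)[OF y])
  have "(a + b)\<^sup>2 \<le> 2 * a\<^sup>2 + 2 * b\<^sup>2" for a b :: real
    using zero_le_power2[of "a - b"] by (simp add: power2_eq_square algebra_simps)
  then show "(vnorm (y - proj x reg n k' *\<^sub>v y))\<^sup>2 \<le> (vnorm (y - proj x reg n k *\<^sub>v y))\<^sup>2
      + 2 * (vnorm (D *\<^sub>v obs_vec x n g))\<^sup>2 + 2 * (vnorm (D *\<^sub>v noise_vec \<epsilon> n \<omega>))\<^sup>2"
    unfolding u(3)[OF y] u(2)[OF obs_vec_carrier] u(2)[OF noise_vec_carrier]
    by (simp add: y_def scalar_prod_data_vec add.assoc)
qed

section \<open>Probabilities of the two exceptional events\<close>

context prob_space
begin

context
  fixes \<epsilon> :: "nat \<Rightarrow> 'a \<Rightarrow> real" and \<sigma> :: real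
  assumes indep: "indep_vars (\<lambda>_. borel) \<epsilon> UNIV"
    and normal: "\<And>i. distributed M lborel (\<epsilon> i) (normal_density 0 \<sigma>)"
    and \<sigma>: "\<sigma> > 0"
begin

lemma standardized_errors:
  "indep_vars (\<lambda>_. borel) (\<lambda>i \<omega>. \<epsilon> i \<omega> / \<sigma>) UNIV"
  "distributed M lborel (\<lambda>\<omega>. \<epsilon> i \<omega> / \<sigma>) std_normal_density"
  using indep_vars_compose2[OF indep, of "\<lambda>_ y. y / \<sigma>" "\<lambda>_. borel"]
    normal_standard_normal_convert[OF \<sigma>, of "\<epsilon> i" 0] normal[of i] by auto

lemma error_measurable [measurable]: "\<epsilon> i \<in> borel_measurable M"
  using normal[of i] by (auto simp: distributed_def)

text \<open>After division by sigma the residual has n - r orthonormal coordinates, with shifts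
  whose squares add up to bias / sigma^2. The threshold is thus a quarter of the mean with the bias
  included.\<close>

lemma residual_lower_tail:
  fixes x :: "nat \<Rightarrow> 'x" and reg :: "'k \<Rightarrow> ('x \<Rightarrow> real) list" and n g k
  defines "A \<equiv> {\<omega> \<in> space M.
      (vnorm (data_vec x \<epsilon> n g \<omega> - proj x reg n k *\<^sub>v data_vec x \<epsilon> n g \<omega>))\<^sup>2
        \<le> (\<sigma>\<^sup>2 * (real n - real (rk x reg n k)) + bias x reg n g k) / 4}"
  shows "A \<in> events" "prob (A) \<le> exp (- (real n - real (rk x reg n k)) / 8)"
proof -
  obtain vs where vs: "orthonormal n vs" "rk x reg n k + length vs = n"
    "\<And>v. v \<in> carrier_vec n \<Longrightarrow>
       (vnorm (v - proj x reg n k *\<^sub>v v))\<^sup>2 = (\<Sum>l<length vs. (vs ! l \<bullet> v)\<^sup>2)"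
    using residual_basis[where x = x and reg = reg and n = n and k = k] by blast
  let ?q = "length vs"
  define m where "m l = vs ! l \<bullet> obs_vec x n g / \<sigma>" for l
  define W where "W \<omega> = (\<Sum>l<?q. ((\<Sum>i<n. vs ! l $ i * (\<epsilon> i \<omega> / \<sigma>)) + m l)\<^sup>2)" for \<omega>
  have q: "real n - real (rk x reg n k) = real ?q" using vs(2) by linarith
  have bias: "bias x reg n g k = \<sigma>\<^sup>2 * (\<Sum>l<?q. (m l)\<^sup>2)"
    using \<sigma> by (simp add: bias_eq vs(3) m_def power_divide sum_divide_distrib[symmetric])
  have res: "(vnorm (data_vec x \<epsilon> n g \<omega> - proj x reg n k *\<^sub>v data_vec x \<epsilon> n g \<omega>))\<^sup>2 = \<sigma>\<^sup>2 * W \<omega>" for \<omega>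
  proof -
    have "vs ! l \<bullet> data_vec x \<epsilon> n g \<omega> = \<sigma> * ((\<Sum>i<n. vs ! l $ i * (\<epsilon> i \<omega> / \<sigma>)) + m l)" for l
      using \<sigma> by (simp add: scalar_prod_data_vec scalar_prod_noise_vec m_def distrib_left sum_distrib_left)
    then show ?thesis by (simp add: vs(3) W_def power_mult_distrib sum_distrib_left)
  qed
  have A: "A = {\<omega> \<in> space M. W \<omega> \<le> (real ?q + (\<Sum>l<?q. (m l)\<^sup>2)) / 4}"
  proof -
    have "\<sigma>\<^sup>2 * w \<le> (\<sigma>\<^sup>2 * a + \<sigma>\<^sup>2 * c) / 4 \<longleftrightarrow> w \<le> (a + c) / 4" for w a c :: real
      using \<sigma> mult_le_cancel_left_pos[of "\<sigma>\<^sup>2" w "(a + c) / 4"] by (simp add: distrib_left)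
    then show ?thesis unfolding A_def q bias res by simp
  qed
  show "A \<in> events" unfolding A W_def by measurable
  have "(\<Sum>i<n. vs ! l $ i * vs ! l' $ i) = (if l = l' then 1 else 0)" if "l < ?q" "l' < ?q" for l l'
    using orthonormal_nth[OF vs(1) that] carrier_vecD[OF orthonormal_carrier[OF vs(1) that(2)]]
    by (simp add: scalar_prod_def atLeast0LessThan)
  from sum_squares_lower_tail[OF standardized_errors, where U = "\<lambda>l i. vs ! l $ i" and m = m, OF this]
  show "prob (A) \<le> exp (- (real n - real (rk x reg n k)) / 8)"
    unfolding A q W_def .
qed

lemma noise_projection_tail:
  fixes x :: "nat \<Rightarrow> 'x" and reg :: "'k \<Rightarrow> ('x \<Rightarrow> real) list" and n k k' s
  assumes "k' \<in> S1 x reg n G k" "s \<ge> 0"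
  defines "A \<equiv> {\<omega> \<in> space M.
      \<sigma>\<^sup>2 * s \<le> (vnorm ((proj x reg n k - proj x reg n k') *\<^sub>v noise_vec \<epsilon> n \<omega>))\<^sup>2}"
  shows "A \<in> events" "prob A \<le> 2 * exp (- s / 2)"
proof -
  obtain u where u: "u \<in> carrier_vec n" "u \<bullet> u = 1"
    "\<And>v. v \<in> carrier_vec n \<Longrightarrow> (vnorm ((proj x reg n k - proj x reg n k') *\<^sub>v v))\<^sup>2 = (u \<bullet> v)\<^sup>2"
    using submodel_direction[OF assms(1)] by metis
  have "(vnorm ((proj x reg n k - proj x reg n k') *\<^sub>v noise_vec \<epsilon> n \<omega>))\<^sup>2
      = \<sigma>\<^sup>2 * (\<Sum>i<n. u $ i * (\<epsilon> i \<omega> / \<sigma>))\<^sup>2" for \<omega>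
    using \<sigma> by (simp add: u(3) scalar_prod_noise_vec power_mult_distrib[symmetric] sum_distrib_left)
  then have A: "A = {\<omega> \<in> space M. s \<le> (\<Sum>i<n. u $ i * (\<epsilon> i \<omega> / \<sigma>))\<^sup>2}"
    using \<sigma> by (simp add: A_def)
  show "A \<in> events" unfolding A by measurable
  have "(\<Sum>i<n. (u $ i)\<^sup>2) = 1"
    using u(1,2) by (simp add: scalar_prod_def atLeast0LessThan power2_eq_square)
  from linear_form_tail[OF standardized_errors this assms(2)]
  show "prob A \<le> 2 * exp (- s / 2)" unfolding A .
qed

end

end

section \<open>The parametricness index\<close>

text \<open>The index is an infimum, so the lower bound needs a property of all submodels and the
  upper bound only one good submodel \<open>k0\<close>.\<close>

lemma PI_index_bounds:
  fixes x reg lam d n G y k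
  defines "s2 \<equiv> sigma2_hat x reg n y k" and "R \<equiv> \<lambda>k. (vnorm (y - proj x reg n k *\<^sub>v y))\<^sup>2"
  assumes fin: "finite G" and k: "rk x reg n k > 1" "rk x reg n k < n"
    and s2: "s2 > 0" and pen: "pen lam d n (rk x reg n k) > 0"
    and lam: "lam * ln (real n) \<ge> 0"
    and lower: "\<And>k'. k' \<in> S1 x reg n G k \<Longrightarrow> R k \<le> R k'"
    and k0: "k0 \<in> S1 x reg n G k" and upper: "R k0 \<le> R k + t * (s2 * pen lam d n (rk x reg n k))"
  shows "1 - lam * ln (real n) / pen lam d n (rk x reg n k) \<le> PI_index x reg lam d n G y k"
    and "PI_index x reg lam d n G y k \<le> 1 + t"
proof -
  let ?p = "pen lam d n (rk x reg n k)"
  let ?q = "\<lambda>k'. IC x reg lam d n y k' s2 / IC x reg lam d n y k s2"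
  \<comment> \<open>The variance is estimated from k itself, so R k cancels n s2 up to - r s2; this
    is the origin of the -1 in the penalty.\<close>
  have R: "R k = s2 * (real n - real (rk x reg n k))"
    using k by (simp add: s2_def R_def sigma2_hat_def)
  have ICk: "IC x reg lam d n y k s2 = s2 * ?p"
    using R by (simp add: IC_def pen_def R_def algebra_simps)
  have q: "?q k' = 1 + (R k' - R k) / (s2 * ?p) - lam * ln (real n) / ?p" if "k' \<in> S1 x reg n G k" for k'
  proof -
    have r: "real (rk x reg n k') = real (rk x reg n k) - 1"
      using that by (auto simp: S1_def)
    have eq: "IC x reg lam d n y k' s2 = s2 * ?p + (R k' - R k) - lam * ln (real n) * s2"
      unfolding R IC_def pen_def r by (simp add: R_def algebra_simps)
    show ?thesis
      unfolding ICk eq using s2 pen by (simp add: add_divide_distrib diff_divide_distrib)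
  qed
  have PI: "PI_index x reg lam d n G y k = (INF k'\<in>S1 x reg n G k. ?q k')"
    using k by (simp add: PI_index_def s2_def Let_def)
  show "1 - lam * ln (real n) / ?p \<le> PI_index x reg lam d n G y k"
    unfolding PI
  proof (rule cINF_greatest)
    fix k' assume k': "k' \<in> S1 x reg n G k"
    then show "1 - lam * ln (real n) / ?p \<le> ?q k'"
      unfolding q[OF k'] using lower[OF k'] s2 pen by simp
  qed (use k0 in auto)
  \<comment> \<open>A real infimum lies below its members only if the set is bounded below;
    finiteness provides this.\<close>
  have "finite (S1 x reg n G k)" using fin by (simp add: S1_def)
  then have "PI_index x reg lam d n G y k \<le> ?q k0"
    unfolding PI by (intro cINF_lower k0 bdd_below_finite finite_imageI)
  also have "\<dots> \<le> 1 + (R k0 - R k) / (s2 * ?p)"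
    unfolding q[OF k0] using lam pen by simp
  also have "(R k0 - R k) / (s2 * ?p) \<le> t"
    using upper s2 pen by (subst pos_divide_le_eq) auto
  finally show "PI_index x reg lam d n G y k \<le> 1 + t" by simp
qed

lemma card_S1_le_max_subs:
  assumes "finite G" "k \<in> G"
  shows "card (S1 x reg n G k) \<le> max_subs x reg n G (rk x reg n k)"
proof -
  have "{card (S1 x reg n G k') | k'. k' \<in> G \<and> rk x reg n k' = rk x reg n k}
      = (\<lambda>k'. card (S1 x reg n G k')) ` {k' \<in> G. rk x reg n k' = rk x reg n k}" by auto
  then show ?thesis
    unfolding max_subs_def using assms by (auto intro!: Max_ge)
qed

text \<open>The expression minimised in \<open>E_ind\<close> and dividing in (N3'). Times sigma^2 it
  is the penalty times the mean of s2 for the fixed model k, the typical size of IC(k).\<close>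

definition spread_pen :: "(nat \<Rightarrow> 'x) \<Rightarrow> ('k \<Rightarrow> ('x \<Rightarrow> real) list) \<Rightarrow> real \<Rightarrow> real
    \<Rightarrow> real \<Rightarrow> nat \<Rightarrow> ('x \<Rightarrow> real) \<Rightarrow> 'k \<Rightarrow> real" where
  "spread_pen x reg \<sigma> lam d n g k = pen lam d n (rk x reg n k)
     * (1 + bias x reg n g k / ((real n - real (rk x reg n k)) * \<sigma>\<^sup>2))"

text \<open>The argument at a single sample size, free of limits and extended reals: \<eta> is the
  tolerance, and the real number \<open>e j\<close> stands for E_j.\<close>

lemma (in prob_space) PI_deviation_bound:
  fixes \<epsilon> :: "nat \<Rightarrow> 'a \<Rightarrow> real" and reg :: "'k \<Rightarrow> ('x \<Rightarrow> real) list" and x :: "nat \<Rightarrow> 'x"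
    and khat :: "'a \<Rightarrow> 'k" and e :: "nat \<Rightarrow> real" and a b n :: nat
    and g :: "'x \<Rightarrow> real" and \<sigma> lam d \<eta> \<rho> c0 t :: real and G :: "'k set"
  defines "L \<equiv> lam * ln (real n)" and "D \<equiv> spread_pen x reg \<sigma> lam d n g"
    and "H \<equiv> {\<omega> \<in> space M. a \<le> rk x reg n (khat \<omega>) \<and> rk x reg n (khat \<omega>) \<le> b}"
  assumes indep: "indep_vars (\<lambda>_. borel) \<epsilon> UNIV"
    and normal: "\<And>i. distributed M lborel (\<epsilon> i) (normal_density 0 \<sigma>)"
    and \<sigma>: "\<sigma> > 0" and d: "d \<ge> 0" and L: "L \<ge> 1"
    and fin: "finite G" and S1_ne: "\<And>k. k \<in> G \<Longrightarrow> rk x reg n k > 1 \<Longrightarrow> S1 x reg n G k \<noteq> {}"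
    and khat: "\<And>\<omega>. \<omega> \<in> space M \<Longrightarrow> khat \<omega> \<in> G"
    and ab: "2 \<le> a" "b < n"
    and \<eta>: "\<eta> > 0" "1 / \<eta> \<le> real a"
    and \<rho>: "\<rho> > 0" "32 * \<rho> \<le> 1" "4 * \<rho> \<le> \<eta>"
    and e_nonneg: "\<And>j. a \<le> j \<Longrightarrow> j \<le> b \<Longrightarrow> 0 \<le> e j"
    and e_le: "\<And>j. a \<le> j \<Longrightarrow> j \<le> b \<Longrightarrow> e j \<le> 2 * (real n - real j)"
    and e_D: "\<And>k. k \<in> G \<Longrightarrow> a \<le> rk x reg n k \<Longrightarrow> rk x reg n k \<le> b \<Longrightarrow> e (rk x reg n k) \<le> D k"
    and pen_ge: "\<And>j. a \<le> j \<Longrightarrow> j \<le> b \<Longrightarrow> 1 / \<eta> \<le> pen lam d n j"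
    and count: "\<And>j. a \<le> j \<Longrightarrow> j \<le> b \<Longrightarrow>
      real (num_models x reg n G j) * real (max_subs x reg n G j) \<le> c0 * exp (\<rho> * e j)"
    and signal: "\<And>k. k \<in> G \<Longrightarrow> a \<le> rk x reg n k \<Longrightarrow> rk x reg n k \<le> b \<Longrightarrow>
      \<exists>k'\<in>S1 x reg n G k. (vnorm ((proj x reg n k - proj x reg n k') *\<^sub>v obs_vec x n g))\<^sup>2 \<le> \<eta> * D k"
    and H: "H \<in> events" and t: "(8 + 8 / \<sigma>\<^sup>2) * \<eta> \<le> t"
  shows "prob {\<omega> \<in> space M. \<bar>PI_index x reg lam d n G (data_vec x \<epsilon> n g \<omega>) (khat \<omega>) - 1\<bar> > t} \<le> 1 - prob H + 3 * c0 * (\<Sum>j=a..b. exp (- (\<rho> * e j)))"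
    (is "prob ?bad \<le> _")
proof -
  let ?r = "rk x reg n"
  let ?y = "data_vec x \<epsilon> n g"
  let ?p = "\<lambda>k. pen lam d n (?r k)"
  define G' where "G' = {k \<in> G. a \<le> ?r k \<and> ?r k \<le> b}"
  define A1 where "A1 k = {\<omega> \<in> space M. (vnorm (?y \<omega> - proj x reg n k *\<^sub>v ?y \<omega>))\<^sup>2
      \<le> (\<sigma>\<^sup>2 * (real n - real (?r k)) + bias x reg n g k) / 4}" for k
  define A2 where "A2 k k' = {\<omega> \<in> space M. \<sigma>\<^sup>2 * (\<eta> * D k)
      \<le> (vnorm ((proj x reg n k - proj x reg n k') *\<^sub>v noise_vec \<epsilon> n \<omega>))\<^sup>2}" for k k'
  define A where "A k = A1 k \<union> (\<Union>k'\<in>S1 x reg n G k. A2 k k')" for k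
  have finS: "finite (S1 x reg n G k)" for k using fin by (simp add: S1_def)
  have finG': "finite G'" using fin by (simp add: G'_def)
  have D_nonneg: "0 \<le> D k" if "k \<in> G'" for k
    using e_D[of k] e_nonneg[of "?r k"] that by (auto simp: G'_def)
  have pen_pos: "0 < ?p k" if "k \<in> G'" for k
    using pen_ge[of "?r k"] that \<eta>(1) by (auto simp: G'_def intro: less_le_trans[of _ "1 / \<eta>"])
  have A1: "A1 k \<in> events" "prob (A1 k) \<le> exp (- (real n - real (?r k)) / 8)" for k
    unfolding A1_def by (rule residual_lower_tail[OF indep normal \<sigma>])+
  have A2: "A2 k k' \<in> events" "prob (A2 k k') \<le> 2 * exp (- (\<eta> * D k) / 2)"
    if "k \<in> G'" "k' \<in> S1 x reg n G k" for k k'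
    unfolding A2_def using D_nonneg[OF that(1)] \<eta>(1)
    by (intro noise_projection_tail[OF indep normal \<sigma> that(2)] mult_nonneg_nonneg; simp)+
  have UA2: "(\<Union>k'\<in>S1 x reg n G k. A2 k k') \<in> events" if "k \<in> G'" for k
    using A2(1)[OF that] by (intro sets.finite_UN finS)
  have A: "A k \<in> events" if "k \<in> G'" for k
    unfolding A_def by (intro sets.Un A1(1) UA2[OF that])
  have UA: "(\<Union>k\<in>G'. A k) \<in> events"
    using A by (intro sets.finite_UN finG')
  have prob_A: "prob (A k) \<le> 3 * real (max_subs x reg n G (?r k)) * exp (- (2 * \<rho> * e (?r k)))"
    if k: "k \<in> G'" for k
  proof -
    let ?j = "?r k"
    let ?E = "exp (- (2 * \<rho> * e ?j))"
    have kG: "k \<in> G" "a \<le> ?j" "?j \<le> b" using k by (auto simp: G'_def)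
    have e0: "0 \<le> e ?j" and e2: "e ?j \<le> 2 * (real n - real ?j)" and eD: "e ?j \<le> D k"
      using e_nonneg e_le e_D kG by auto
    \<comment> \<open>The bound 32 \<rho> <= 1 is chosen for this: 1/16 times 2 (n - j) is the
      exponent (n - j) / 8 of the residual tail. Likewise 4 \<rho> <= \<eta> matches the noise tail
      below.\<close>
    have "2 * \<rho> * e ?j \<le> 1 / 16 * e ?j" using \<rho>(2) e0 by (intro mult_right_mono) auto
    then have E1: "exp (- (real n - real ?j) / 8) \<le> ?E" using e2 by simp
    have "2 * \<rho> * e ?j \<le> \<eta> / 2 * D k" using \<rho> e0 eD \<eta>(1) by (intro mult_mono) auto
    then have E2: "2 * exp (- (\<eta> * D k) / 2) \<le> 2 * ?E" by simp
    \<comment> \<open>With at least one submodel, the residual event can be charged to the submodels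
      as well. Each of them then carries three units, one for the residual and two for the two-sided
      noise tail.\<close>
    have "S1 x reg n G k \<noteq> {}" using S1_ne kG ab by auto
    then have c1: "1 \<le> real (card (S1 x reg n G k))"
      using finS by (simp add: Suc_le_eq card_gt_0_iff)
    have "prob (A k) \<le> prob (A1 k) + prob (\<Union>k'\<in>S1 x reg n G k. A2 k k')"
      unfolding A_def by (intro measure_Un_le A1(1) UA2[OF k])
    also have "prob (\<Union>k'\<in>S1 x reg n G k. A2 k k') \<le> (\<Sum>k'\<in>S1 x reg n G k. prob (A2 k k'))"
      using A2(1)[OF k] by (intro finite_measure_subadditive_finite finS) blast
    also have "\<dots> \<le> (\<Sum>k'\<in>S1 x reg n G k. 2 * ?E)"
      by (intro sum_mono order_trans[OF A2(2)[OF k] E2])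
    also have "\<dots> = real (card (S1 x reg n G k)) * (2 * ?E)" by simp
    also have "prob (A1 k) \<le> real (card (S1 x reg n G k)) * ?E"
      using order_trans[OF A1(2) E1] mult_right_mono[OF c1 exp_ge_zero] by (simp only: mult_1_left) (rule order_trans)
    finally have "prob (A k) \<le> 3 * real (card (S1 x reg n G k)) * ?E" by simp
    also have "\<dots> \<le> 3 * real (max_subs x reg n G ?j) * ?E"
      using card_S1_le_max_subs[OF fin kG(1)] by (intro mult_right_mono) auto
    finally show ?thesis .
  qed
  have level: "(\<Sum>k\<in>{k \<in> G. ?r k = j}. prob (A k)) \<le> 3 * c0 * exp (- (\<rho> * e j))"
    if j: "a \<le> j" "j \<le> b" for j
  proof -
    have "(\<Sum>k\<in>{k \<in> G. ?r k = j}. prob (A k))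
        \<le> (\<Sum>k\<in>{k \<in> G. ?r k = j}. 3 * real (max_subs x reg n G j) * exp (- (2 * \<rho> * e j)))"
      using prob_A j by (intro sum_mono) (auto simp: G'_def)
    also have "\<dots> = 3 * (real (num_models x reg n G j) * real (max_subs x reg n G j))
        * exp (- (2 * \<rho> * e j))"
      by (simp add: num_models_def)
    \<comment> \<open>Half of the exponent absorbs the number of pairs of a model and a
      submodel.\<close>
    also have "\<dots> \<le> 3 * (c0 * exp (\<rho> * e j)) * exp (- (2 * \<rho> * e j))"
      using count[OF j] by (intro mult_right_mono mult_left_mono) auto
    also have "\<dots> = 3 * c0 * (exp (\<rho> * e j) * exp (- (2 * \<rho> * e j)))" by simp
    also have "exp (\<rho> * e j) * exp (- (2 * \<rho> * e j)) = exp (- (\<rho> * e j))"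
      by (simp add: exp_add[symmetric])
    finally show ?thesis .
  qed
  have G'_eq: "G' = (\<Union>j\<in>{a..b}. {k \<in> G. ?r k = j})" by (auto simp: G'_def)
  have "prob (\<Union>k\<in>G'. A k) \<le> (\<Sum>k\<in>G'. prob (A k))"
    using A by (intro finite_measure_subadditive_finite finG') blast
  also have "\<dots> = (\<Sum>j=a..b. \<Sum>k\<in>{k \<in> G. ?r k = j}. prob (A k))"
    unfolding G'_eq using fin by (intro sum.UNION_disjoint) auto
  also have "\<dots> \<le> (\<Sum>j=a..b. 3 * c0 * exp (- (\<rho> * e j)))"
    using level by (intro sum_mono) auto
  finally have union: "prob (\<Union>k\<in>G'. A k) \<le> 3 * c0 * (\<Sum>j=a..b. exp (- (\<rho> * e j)))"
    by (simp add: sum_distrib_left)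
  have good: "\<bar>PI_index x reg lam d n G (?y \<omega>) (khat \<omega>) - 1\<bar> \<le> (8 + 8 / \<sigma>\<^sup>2) * \<eta>"
    if \<omega>: "\<omega> \<in> H" "\<omega> \<notin> (\<Union>k\<in>G'. A k)" for \<omega>
  proof -
    define k where "k = khat \<omega>"
    have \<omega>M: "\<omega> \<in> space M" and k: "k \<in> G'"
      using \<omega>(1) khat by (auto simp: H_def G'_def k_def)
    then have kG: "k \<in> G" "a \<le> ?r k" "?r k \<le> b" and rn: "?r k > 1" "?r k < n"
      using ab by (auto simp: G'_def)
    let ?R = "\<lambda>k. (vnorm (?y \<omega> - proj x reg n k *\<^sub>v ?y \<omega>))\<^sup>2"
    let ?s2 = "sigma2_hat x reg n (?y \<omega>) k"
    let ?q = "real n - real (?r k)"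
    have q: "?q > 0" using rn by simp
    have "\<omega> \<notin> A1 k" using \<omega>(2) k by (auto simp: A_def)
    then have "(\<sigma>\<^sup>2 * ?q + bias x reg n g k) / 4 < ?R k" using \<omega>M by (simp add: A1_def)
    then have "(\<sigma>\<^sup>2 * ?q + bias x reg n g k) / 4 / ?q < ?s2"
      using q unfolding sigma2_hat_def by (intro divide_strict_right_mono)
    moreover have "(\<sigma>\<^sup>2 * ?q + bias x reg n g k) / 4 / ?q
        = \<sigma>\<^sup>2 / 4 * (1 + bias x reg n g k / (?q * \<sigma>\<^sup>2))"
      using q \<sigma> by (simp add: field_simps)
    ultimately have s2: "\<sigma>\<^sup>2 / 4 * (1 + bias x reg n g k / (?q * \<sigma>\<^sup>2)) < ?s2"
      by (simp only:)
    have "0 \<le> \<sigma>\<^sup>2 / 4 * (1 + bias x reg n g k / (?q * \<sigma>\<^sup>2))"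
      using bias_nonneg[of x reg n g k] q by (intro mult_nonneg_nonneg add_nonneg_nonneg) auto
    then have s2_pos: "?s2 > 0" using s2 by linarith
    have "\<sigma>\<^sup>2 / 4 * D k \<le> ?s2 * ?p k"
      using mult_right_mono[OF less_imp_le[OF s2], of "?p k"] pen_pos[OF k]
      \<comment> \<open>The bias factor in the lower bound for s2 is the one in
        \<open>spread_pen\<close>, so D k is controlled by s2 p.\<close>
      by (simp add: D_def spread_pen_def mult_ac)
    then have D_le: "D k \<le> 4 / \<sigma>\<^sup>2 * (?s2 * ?p k)"
      using \<sigma> by (simp add: field_simps)
    obtain k0 where k0: "k0 \<in> S1 x reg n G k"
      "(vnorm ((proj x reg n k - proj x reg n k0) *\<^sub>v obs_vec x n g))\<^sup>2 \<le> \<eta> * D k"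
      using signal[OF kG] by blast
    \<comment> \<open>Since k is random, so is \<open>k0\<close>; the exceptional set runs over all
      pairs and covers this choice.\<close>
    have "\<omega> \<notin> A2 k k0" using \<omega>(2) k k0(1) by (auto simp: A_def)
    then have "(vnorm ((proj x reg n k - proj x reg n k0) *\<^sub>v noise_vec \<epsilon> n \<omega>))\<^sup>2 \<le> \<sigma>\<^sup>2 * (\<eta> * D k)"
      using \<omega>M by (simp add: A2_def)
    then have "?R k0 \<le> ?R k + 2 * (\<eta> * D k) + 2 * (\<sigma>\<^sup>2 * (\<eta> * D k))"
      using submodel_residual_bounds(2)[OF k0(1), of \<epsilon> g \<omega>] k0(2) by linarith
    \<comment> \<open>The constant 8 + 8 / sigma^2 is 2 (1 + sigma^2) times 4 / sigma^2: the 2 from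
      splitting the square, the 4 from the quarter of the mean.\<close>
    also have "\<dots> = ?R k + 2 * (1 + \<sigma>\<^sup>2) * \<eta> * D k" by (simp add: algebra_simps)
    also have "2 * (1 + \<sigma>\<^sup>2) * \<eta> * D k \<le> 2 * (1 + \<sigma>\<^sup>2) * \<eta> * (4 / \<sigma>\<^sup>2 * (?s2 * ?p k))"
      using D_le \<eta>(1) by (intro mult_left_mono) auto
    also have "\<dots> = ((8 + 8 / \<sigma>\<^sup>2) * \<eta>) * (?s2 * ?p k)"
      using \<sigma> by (simp add: field_simps)
    finally have up: "?R k0 \<le> ?R k + ((8 + 8 / \<sigma>\<^sup>2) * \<eta>) * (?s2 * ?p k)" by simp
    have "0 \<le> lam * ln (real n)" using L by (simp add: L_def)
    note PI = PI_index_bounds[OF fin rn s2_pos pen_pos[OF k] this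
        submodel_residual_bounds(1)[of _ x reg n G k \<epsilon> g \<omega>] k0(1) up]
    \<comment> \<open>A large penalty alone is not enough, as L may itself be unbounded. But p >= (L
      - 1) r, so (L - 1) / p is at most 1 / r, and r >= a >= 1 / \<eta>.\<close>
    have "L / ?p k = (L - 1) / ?p k + 1 / ?p k" by (simp add: diff_divide_distrib)
    also have "(L - 1) / ?p k \<le> \<eta>"
    proof -
      have "(L - 1) * (1 / \<eta>) \<le> (L - 1) * real (?r k)"
        using L \<eta>(2) kG(2) by (intro mult_left_mono) auto
      also have "\<dots> \<le> ?p k"
        using d rn by (simp add: pen_def L_def)
      finally show ?thesis
        using pen_pos[OF k] \<eta>(1) by (simp add: field_simps)
    qed
    also have "1 / ?p k \<le> \<eta>"
      using pen_ge[OF kG(2,3)] pen_pos[OF k] \<eta>(1) by (simp add: field_simps)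
    finally have "L / ?p k \<le> 2 * \<eta>" by simp
    also have "\<dots> \<le> (8 + 8 / \<sigma>\<^sup>2) * \<eta>"
      using \<eta>(1) by (intro mult_right_mono) (auto intro: add_increasing2)
    finally show ?thesis using PI unfolding L_def k_def by (simp add: abs_le_iff)
  qed
  \<comment> \<open>Nothing is claimed on measurability of the left-hand side: if it is not an event, its measure is 0.\<close>
  have bad_sub: "?bad \<subseteq> (space M - H) \<union> (\<Union>k\<in>G'. A k)"
    using good t by fastforce
  have "prob ?bad \<le> prob ((space M - H) \<union> (\<Union>k\<in>G'. A k))"
    by (intro finite_measure_mono bad_sub sets.Un sets.compl_sets H UA)
  also have "\<dots> \<le> prob (space M - H) + prob (\<Union>k\<in>G'. A k)"
    by (intro measure_Un_le sets.compl_sets H UA)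
  also have "prob (space M - H) = 1 - prob H"
    using H by (rule prob_compl)
  finally show ?thesis using union by simp
qed

section \<open>Real consequences of the extended-real conditions\<close>

lemma ereal_divide_less_imp:
  fixes z :: ereal
  assumes "z / ereal c < ereal t" "c > 0"
  shows "z < ereal (t * c)"
  using assms by (cases z) (auto simp: field_simps)

lemma exp_ereal_ereal [simp]: "exp_ereal (ereal r) = ereal (exp r)"
  by (simp add: exp_ereal_def)

lemma exp_ereal_nonneg: "exp_ereal z \<ge> 0"
  by (simp add: exp_ereal_def)

lemma pen_nonneg:
  assumes "lam * ln (real n) \<ge> 1" "d \<ge> 0" "n \<ge> 1"
  shows "pen lam d n j \<ge> 0"
  using assms by (simp add: pen_def)

text \<open>A finite upper bound also excludes an empty rank level, where the infimum is
  infinite.\<close>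

lemma small_B_ind_imp:
  assumes "B_ind x reg \<sigma> lam d n G g j / ereal (real n - real j) < ereal \<eta>" "j < n"
  obtains k where "k \<in> G" "rk x reg n k = j"
    "pen lam d n j + bias x reg n g k / \<sigma>\<^sup>2 < \<eta> * (real n - real j)"
proof -
  have "B_ind x reg \<sigma> lam d n G g j < ereal (\<eta> * (real n - real j))"
    using ereal_divide_less_imp[OF assms(1)] assms(2) by simp
  then obtain k where "k \<in> {k \<in> G. rk x reg n k = j}"
    "ereal ((lam * ln (real n) - 1) * real j + bias x reg n g k / \<sigma>\<^sup>2 + d * sqrt (real n) * ln (real n))
      < ereal (\<eta> * (real n - real j))"
    unfolding B_ind_def INF_less_iff by blast
  then show thesis using that[of k] by (simp add: pen_def algebra_simps)
qed

lemma E_ind_eq: "E_ind x reg \<sigma> lam d n G g j = (INF k\<in>{k \<in> G. rk x reg n k = j}. ereal (spread_pen x reg \<sigma> lam d n g k))"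
  unfolding E_ind_def spread_pen_def by (intro INF_cong) auto

text \<open>The hypothesis on k bounds two nonnegative summands at once: the bias term makes the
  factor in \<open>spread_pen\<close> at most 2, and the penalty itself is at most n - j. Finiteness
  of the infimum follows, which yields a real e.\<close>

lemma E_ind_bounds:
  assumes "j < n" "0 \<le> pen lam d n j" "k \<in> G" "rk x reg n k = j"
    and "pen lam d n j + bias x reg n g k / \<sigma>\<^sup>2 \<le> real n - real j" "\<sigma> > 0"
  obtains e where "E_ind x reg \<sigma> lam d n G g j = ereal e" "0 \<le> e" "e \<le> 2 * pen lam d n j"
    "e \<le> 2 * (real n - real j)" "\<And>k. k \<in> G \<Longrightarrow> rk x reg n k = j \<Longrightarrow> e \<le> spread_pen x reg \<sigma> lam d n g k"
proof -
  let ?E = "E_ind x reg \<sigma> lam d n G g j"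
  have jn: "0 < real n - real j" using assms(1) by simp
  have le: "?E \<le> ereal (spread_pen x reg \<sigma> lam d n g k')" if "k' \<in> G" "rk x reg n k' = j" for k'
    unfolding E_ind_eq using that by (intro INF_lower) auto
  have "0 \<le> spread_pen x reg \<sigma> lam d n g k'" if "rk x reg n k' = j" for k'
    unfolding spread_pen_def that using assms(2) jn bias_nonneg[of x reg n g k'] by auto
  then have ge: "0 \<le> ?E" unfolding E_ind_eq by (intro INF_greatest) (auto simp: zero_ereal_def)
  have "bias x reg n g k / \<sigma>\<^sup>2 \<le> real n - real j" using assms(2,5) by linarith
  then have "bias x reg n g k / ((real n - real j) * \<sigma>\<^sup>2) \<le> 1"
    using jn assms(6) by (simp add: pos_divide_le_eq mult_pos_pos)
  then have "pen lam d n j * (1 + bias x reg n g k / ((real n - real j) * \<sigma>\<^sup>2)) \<le> pen lam d n j * 2"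
    by (intro mult_left_mono assms(2)) simp
  then have D: "spread_pen x reg \<sigma> lam d n g k \<le> 2 * pen lam d n j"
    by (simp add: spread_pen_def assms(4))
  obtain e where e: "?E = ereal e"
    using ge le[OF assms(3,4)] by (cases ?E) auto
  have ek: "e \<le> spread_pen x reg \<sigma> lam d n g k'" if "k' \<in> G" "rk x reg n k' = j" for k'
    using le[OF that] e by simp
  have "pen lam d n j \<le> real n - real j"
    using assms(5) bias_nonneg[of x reg n g k] by (smt (verit) divide_nonneg_nonneg zero_le_power2)
  then show thesis
    using that[OF e] ge e ek[OF assms(3,4)] D ek by auto
qed

lemma small_S1_INF_imp:
  fixes x reg n G g k
  assumes "(INF k'\<in>S1 x reg n G k.
      ereal ((vnorm ((proj x reg n k - proj x reg n k') *\<^sub>v obs_vec x n g))\<^sup>2)) / ereal D < ereal \<eta>" "D > 0"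
  shows "\<exists>k'\<in>S1 x reg n G k. (vnorm ((proj x reg n k - proj x reg n k') *\<^sub>v obs_vec x n g))\<^sup>2 \<le> \<eta> * D"
  using ereal_divide_less_imp[OF assms] unfolding INF_less_iff by (auto intro: less_imp_le)

section \<open>Passage to the limit\<close>

theorem theorem3:
  fixes M :: "'w measure"
    and x :: "nat \<Rightarrow> real ^ 'p"
    and f :: "nat \<Rightarrow> real ^ 'p \<Rightarrow> real"
    and \<epsilon> :: "nat \<Rightarrow> 'w \<Rightarrow> real"
    and \<sigma> d c0 :: real
    and lam \<rho> :: "nat \<Rightarrow> real"
    and reg :: "'k \<Rightarrow> (real ^ 'p \<Rightarrow> real) list"
    and \<Gamma> :: "nat \<Rightarrow> 'k set"
    and sel :: "nat \<Rightarrow> real Matrix.vec \<Rightarrow> 'k"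
    and khat :: "nat \<Rightarrow> 'w \<Rightarrow> 'k"
    and a b :: "nat \<Rightarrow> nat"
  assumes prob: "prob_space M"
    and errors_indep: "prob_space.indep_vars M (\<lambda>_. borel) \<epsilon> UNIV"
    and errors_normal: "\<And>i. distributed M lborel (\<epsilon> i) (normal_density 0 \<sigma>)"
    and sigma_pos: "\<sigma> > 0"
    and d_nonneg: "d \<ge> 0"
    and lam_ge: "\<And>n. n \<ge> 2 \<Longrightarrow> lam n \<ge> 1 / ln (real n)"
    and Gamma_finite: "\<And>n. n \<ge> 1 \<Longrightarrow> finite (\<Gamma> n)"
    and S1_nonempty: "\<And>n k. n \<ge> 1 \<Longrightarrow> k \<in> \<Gamma> n \<Longrightarrow> rk x reg n k > 1 \<Longrightarrow> S1 x reg n (\<Gamma> n) k \<noteq> {}"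
    and nonparametric: "\<And>n k. n \<ge> 1 \<Longrightarrow> k \<in> \<Gamma> n \<Longrightarrow> f n \<notin> model_family (reg k)"
    and sel_measurable: "\<And>n. n \<ge> 1 \<Longrightarrow>
          (\<lambda>y. sel n (Matrix.vec n y)) \<in> measurable (Pi\<^sub>M {..<n} (\<lambda>_. borel)) (count_space (\<Gamma> n))"
    and khat: "\<And>n \<omega>. khat n \<omega> = sel n (data_vec x \<epsilon> n (f n) \<omega>)"
    and sel_consistent: "potentially_consistent M \<epsilon> x reg \<Gamma> sel"
    and ab: "\<And>n. n \<ge> 3 \<Longrightarrow> 1 \<le> a n \<and> a n < b n \<and> b n < n"
    and a_inf: "filterlim a at_top sequentially"
    and N1_rank: "(\<lambda>n. measure M {\<omega> \<in> space M. a n \<le> rk x reg n (khat n \<omega>) \<and>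
                     rk x reg n (khat n \<omega>) \<le> b n}) \<longlonglongrightarrow> 1"
    and N1_B: "(\<lambda>n. SUP j\<in>{a n..b n}.
                  B_ind x reg \<sigma> (lam n) d n (\<Gamma> n) (f n) j / ereal (real n - real j)) \<longlonglongrightarrow> 0"
    and rho_pos: "\<And>n. \<rho> n > 0"
    and rho_lim: "\<rho> \<longlonglongrightarrow> 0"
    and c0_pos: "c0 > 0"
    and N2_count: "\<And>n j. n \<ge> 3 \<Longrightarrow> a n \<le> j \<Longrightarrow> j \<le> b n \<Longrightarrow>
          ereal (real (num_models x reg n (\<Gamma> n) j) * real (max_subs x reg n (\<Gamma> n) j))
            \<le> ereal c0 * exp_ereal (ereal (\<rho> n) * E_ind x reg \<sigma> (lam n) d n (\<Gamma> n) (f n) j)"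
    and N2_sum: "limsup (\<lambda>n. \<Sum>j=a n..b n.
          exp_ereal (- (ereal (\<rho> n) * E_ind x reg \<sigma> (lam n) d n (\<Gamma> n) (f n) j))) = 0"
    and N3: "limsup (\<lambda>n. SUP k\<in>{k \<in> \<Gamma> n. a n \<le> rk x reg n k \<and> rk x reg n k \<le> b n}.
          (INF k'\<in>S1 x reg n (\<Gamma> n) k.
             ereal ((vnorm ((proj x reg n k - proj x reg n k') *\<^sub>v obs_vec x n (f n)))\<^sup>2))
          / ereal (pen (lam n) d n (rk x reg n k)
                   * (1 + bias x reg n (f n) k / (\<sigma>\<^sup>2 * (real n - real (rk x reg n k)))))) = 0"
  shows "tendsto_in_prob M
           (\<lambda>n \<omega>. PI_index x reg (lam n) d n (\<Gamma> n) (data_vec x \<epsilon> n (f n) \<omega>) (khat n \<omega>)) 1"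

proof -
  interpret prob_space M by (rule prob)
  let ?r = "\<lambda>n. rk x reg n"
  let ?y = "\<lambda>n. data_vec x \<epsilon> n (f n)"
  let ?E = "\<lambda>n. E_ind x reg \<sigma> (lam n) d n (\<Gamma> n) (f n)"
  define H where "H n = {\<omega> \<in> space M. a n \<le> ?r n (khat n \<omega>) \<and> ?r n (khat n \<omega>) \<le> b n}" for n
  define S where "S n = (\<Sum>j=a n..b n. exp_ereal (- (ereal (\<rho> n) * ?E n j)))" for n
  have khat_in: "khat n \<omega> \<in> \<Gamma> n" if "n \<ge> 1" for n \<omega>
  proof -
    \<comment> \<open>Membership in \<open>\<Gamma> n\<close> is read off from measurability into
      \<open>count_space\<close>. The restriction puts the data into the product space, and
      \<open>Matrix.vec n\<close> does not see it.\<close>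
    let ?z = "\<lambda>i\<in>{..<n}. f n (x i) + \<epsilon> i \<omega>"
    have "?z \<in> space (Pi\<^sub>M {..<n} (\<lambda>_. borel))" by (auto simp: space_PiM)
    from measurable_space[OF sel_measurable[OF that] this]
    have "sel n (Matrix.vec n ?z) \<in> \<Gamma> n" by simp
    moreover have "Matrix.vec n ?z = ?y n \<omega>" by (auto simp: data_vec_def)
    ultimately show ?thesis by (simp add: khat)
  qed
  have S_small: "\<forall>\<^sub>F n in sequentially. S n < ereal t" if "t > 0" for t
    using N2_sum that by (intro Limsup_lessD) (simp add: S_def)
  have bound: "\<forall>\<^sub>F n in sequentially.
      measure M {\<omega> \<in> space M. \<bar>PI_index x reg (lam n) d n (\<Gamma> n) (?y n \<omega>) (khat n \<omega>) - 1\<bar> > t}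
        \<le> 1 - prob (H n) + 3 * c0 * real_of_ereal (S n)"
    if t: "t > 0" for t
  proof -
    define C where "C = 8 + 8 / \<sigma>\<^sup>2"
    \<comment> \<open>The quotient t / C makes the final error at most t; the cap 1 turns the bound
      from (N1) into one by n - j.\<close>
    define \<eta> where "\<eta> = min 1 (t / C)"
    have "C > 0" using sigma_pos by (simp add: C_def add_pos_nonneg)
    then have \<eta>: "\<eta> > 0" "\<eta> \<le> 1" "C * \<eta> \<le> t"
      using t by (auto simp: \<eta>_def min_def field_simps)
    have "\<forall>\<^sub>F n in sequentially. n \<ge> 3" by (rule eventually_ge_at_top)
    \<comment> \<open>From 2 on, the selected rank exceeds 1 and the index is a genuine infimum, not
      its default value n.\<close>
    moreover have "\<forall>\<^sub>F n in sequentially. a n \<ge> max 2 (nat \<lceil>1 / \<eta>\<rceil>)"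
      using a_inf unfolding filterlim_at_top by blast
    moreover have "\<forall>\<^sub>F n in sequentially. \<rho> n < min (1 / 32) (\<eta> / 4)"
      using order_tendstoD(2)[OF rho_lim, of "min (1 / 32) (\<eta> / 4)"] \<eta> by simp
    \<comment> \<open>Any positive bound would do: it serves to show that \<open>H n\<close> is an
      event.\<close>
    moreover have "\<forall>\<^sub>F n in sequentially. prob (H n) > 1 / 2"
      using order_tendstoD(1)[OF N1_rank, of "1 / 2"] by (simp add: H_def)
    moreover have "\<forall>\<^sub>F n in sequentially. (SUP j\<in>{a n..b n}.
        B_ind x reg \<sigma> (lam n) d n (\<Gamma> n) (f n) j / ereal (real n - real j)) < ereal \<eta>"
      using order_tendstoD(2)[OF N1_B, of "ereal \<eta>"] \<eta> by simp
    moreover have "\<forall>\<^sub>F n in sequentially. (SUP k\<in>{k \<in> \<Gamma> n. a n \<le> ?r n k \<and> ?r n k \<le> b n}.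
          (INF k'\<in>S1 x reg n (\<Gamma> n) k.
             ereal ((vnorm ((proj x reg n k - proj x reg n k') *\<^sub>v obs_vec x n (f n)))\<^sup>2))
          / ereal (pen (lam n) d n (?r n k)
                   * (1 + bias x reg n (f n) k / (\<sigma>\<^sup>2 * (real n - real (?r n k)))))) < ereal \<eta>"
      using N3 \<eta> by (intro Limsup_lessD) simp
    moreover have "\<forall>\<^sub>F n in sequentially. S n < ereal (exp (- 1))"
      by (rule S_small) simp
    ultimately show ?thesis
    proof eventually_elim
      case (elim n)
      let ?pen = "pen (lam n) d n"
      have ab_n: "a n < b n" "b n < n" using ab elim(1) by auto
      have a2: "2 \<le> a n" "1 / \<eta> \<le> real (a n)" using elim(2) by linarith+
      have lnn: "ln (real n) > 0" using elim(1) by simp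
      have L: "1 \<le> lam n * ln (real n)"
        using lam_ge[of n] elim(1) lnn by (simp add: field_simps)
      have fin: "finite (\<Gamma> n)" using Gamma_finite elim(1) by simp
      have pen0: "0 \<le> ?pen j" for j using pen_nonneg[OF L d_nonneg] elim(1) by simp
      have "\<exists>e. ?E n j = ereal e \<and> 0 \<le> e \<and> e \<le> 2 * ?pen j \<and> e \<le> 2 * (real n - real j) \<and>
          (\<forall>k\<in>\<Gamma> n. ?r n k = j \<longrightarrow> e \<le> spread_pen x reg \<sigma> (lam n) d n (f n) k)"
        if j: "j \<in> {a n..b n}" for j
      proof -
        have "B_ind x reg \<sigma> (lam n) d n (\<Gamma> n) (f n) j / ereal (real n - real j) < ereal \<eta>"
          using le_less_trans[OF SUP_upper[OF j] elim(5)] .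
        moreover have jn: "j < n" using j ab_n by simp
        ultimately obtain k where k: "k \<in> \<Gamma> n" "?r n k = j"
          "?pen j + bias x reg n (f n) k / \<sigma>\<^sup>2 < \<eta> * (real n - real j)"
          by (rule small_B_ind_imp)
        have "\<eta> * (real n - real j) \<le> 1 * (real n - real j)"
          using \<eta> jn by (intro mult_right_mono) auto
        then have "?pen j + bias x reg n (f n) k / \<sigma>\<^sup>2 \<le> real n - real j" using k(3) by simp
        from E_ind_bounds[where x = x and reg = reg, OF jn pen0 k(1,2) this sigma_pos]
        show ?thesis by metis
      qed
      then obtain e where e: "\<And>j. j \<in> {a n..b n} \<Longrightarrow> ?E n j = ereal (e j) \<and> 0 \<le> e j \<and> e j \<le> 2 * ?pen j
          \<and> e j \<le> 2 * (real n - real j) \<and>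
          (\<forall>k\<in>\<Gamma> n. ?r n k = j \<longrightarrow> e j \<le> spread_pen x reg \<sigma> (lam n) d n (f n) k)"
        by metis
      have S_eq: "S n = ereal (\<Sum>j=a n..b n. exp (- (\<rho> n * e j)))"
        unfolding S_def using e by (simp flip: sum_ereal)
      have pen_ge: "1 / \<eta> \<le> ?pen j" if j: "j \<in> {a n..b n}" for j
      proof -
        \<comment> \<open>One summand is at most the whole sum, which is below exp (- 1); hence
          \<rho> e > 1. As \<rho> < \<eta> / 4 and e is at most twice the penalty, the penalty is at
          least 2 / \<eta>.\<close>
        have "exp (- (\<rho> n * e j)) \<le> (\<Sum>j=a n..b n. exp (- (\<rho> n * e j)))"
          using j by (intro member_le_sum) auto
        also have "\<dots> < exp (- 1)" using elim(7) unfolding S_eq by simp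
        finally have "1 \<le> \<rho> n * e j" by simp
        also have "\<dots> \<le> \<eta> / 4 * (2 * ?pen j)"
          using e[OF j] elim(3) \<eta>(1) pen0 by (intro mult_mono) auto
        finally show ?thesis using \<eta>(1) pen0[of j] by (simp add: field_simps)
      qed
      have "prob {\<omega> \<in> space M. \<bar>PI_index x reg (lam n) d n (\<Gamma> n) (?y n \<omega>) (khat n \<omega>) - 1\<bar> > t}
          \<le> 1 - prob {\<omega> \<in> space M. a n \<le> ?r n (khat n \<omega>) \<and> ?r n (khat n \<omega>) \<le> b n}
          + 3 * c0 * (\<Sum>j=a n..b n. exp (- (\<rho> n * e j)))"
      proof (rule PI_deviation_bound[OF errors_indep errors_normal sigma_pos d_nonneg L fin])
        fix k assume k: "k \<in> \<Gamma> n"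
        show "S1 x reg n (\<Gamma> n) k \<noteq> {}" if "1 < ?r n k"
          using S1_nonempty k that elim(1) by simp
        assume r: "a n \<le> ?r n k" "?r n k \<le> b n"
        show "e (?r n k) \<le> spread_pen x reg \<sigma> (lam n) d n (f n) k"
          using e[of "?r n k"] r k by simp
        have "?pen (?r n k) > 0"
          using pen_ge[of "?r n k"] r \<eta>(1) by (auto intro: less_le_trans[of _ "1 / \<eta>"])
        moreover have "0 \<le> bias x reg n (f n) k / (\<sigma>\<^sup>2 * (real n - real (?r n k)))"
          using bias_nonneg[of x reg n "f n" k] r ab_n by auto
        ultimately have D: "?pen (?r n k) * (1 + bias x reg n (f n) k / (\<sigma>\<^sup>2 * (real n - real (?r n k)))) > 0"
          by (intro mult_pos_pos) auto
        have "k \<in> {k \<in> \<Gamma> n. a n \<le> ?r n k \<and> ?r n k \<le> b n}" using k r by simp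
        from small_S1_INF_imp[OF le_less_trans[OF SUP_upper[OF this] elim(6)] D]
        show "\<exists>k'\<in>S1 x reg n (\<Gamma> n) k. (vnorm ((proj x reg n k - proj x reg n k') *\<^sub>v obs_vec x n (f n)))\<^sup>2
            \<le> \<eta> * spread_pen x reg \<sigma> (lam n) d n (f n) k"
          by (simp add: spread_pen_def mult.commute)
      next
        fix j assume j: "a n \<le> j" "j \<le> b n"
        then have jn: "j \<in> {a n..b n}" by simp
        show "0 \<le> e j" "e j \<le> 2 * (real n - real j)" using e[OF jn] by auto
        show "1 / \<eta> \<le> ?pen j" by (rule pen_ge[OF jn])
        show "real (num_models x reg n (\<Gamma> n) j) * real (max_subs x reg n (\<Gamma> n) j) \<le> c0 * exp (\<rho> n * e j)"
          using N2_count[OF elim(1) j] e[OF jn] by simp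
      next
        show "{\<omega> \<in> space M. a n \<le> ?r n (khat n \<omega>) \<and> ?r n (khat n \<omega>) \<le> b n} \<in> events"
          \<comment> \<open>A set outside the sigma-algebra would have measure 0.\<close>
          using elim(4) measure_notin_sets[of "H n" M] unfolding H_def by fastforce
      next
        show "(8 + 8 / \<sigma>\<^sup>2) * \<eta> \<le> t" using \<eta>(3) by (simp add: C_def)
      qed (use elim khat_in a2 ab_n \<eta>(1,2) rho_pos in auto)
      then show ?case
        unfolding S_eq by (simp add: H_def)
    qed
  qed
  have S_lim: "(\<lambda>n. real_of_ereal (S n)) \<longlonglongrightarrow> 0"
  proof (rule tendstoI)
    fix t :: real assume "t > 0"
    have S0: "0 \<le> S n" for n
      unfolding S_def by (intro sum_nonneg exp_ereal_nonneg)
    show "\<forall>\<^sub>F n in sequentially. dist (real_of_ereal (S n)) 0 < t"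
      using S_small[OF \<open>t > 0\<close>]
    proof eventually_elim
      case (elim n)
      then show ?case using S0[of n] by (cases "S n") auto
    qed
  qed
  have "(\<lambda>n. 1 - prob (H n) + 3 * c0 * real_of_ereal (S n)) \<longlonglongrightarrow> 1 - 1 + 3 * c0 * 0"
    by (intro tendsto_add tendsto_diff tendsto_mult tendsto_const S_lim N1_rank[folded H_def])
  then have rhs_lim: "(\<lambda>n. 1 - prob (H n) + 3 * c0 * real_of_ereal (S n)) \<longlonglongrightarrow> 0" by simp
  show ?thesis
    unfolding tendsto_in_prob_def
  proof (intro allI impI)
    fix t :: real assume t: "t > 0"
    show "(\<lambda>n. measure M {\<omega> \<in> space M.
        \<bar>PI_index x reg (lam n) d n (\<Gamma> n) (?y n \<omega>) (khat n \<omega>) - 1\<bar> > t}) \<longlonglongrightarrow> 0"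
      by (rule tendsto_sandwich[OF _ bound[OF t] tendsto_const rhs_lim]) simp
  qed
qed

end
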